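(* Let $k$ be an algebraically closed field, let $\mathcal{N}$ be the nilpotent cone of $\mathfrak{sl}_3$ over $k$, and let $\overline{\mathcal{O}_{\mathrm{sub}}}$ be the closure of the subregular nilpotent orbit $\mathcal{O}_{\mathrm{sub}}$ in $\mathcal{N}$. For each $r\ge 1$, let $C_r^{\mathrm{sing}}$ be the singular locus of $C_r(\mathcal{N})$. Then $C_r^{\mathrm{sing}}\subseteq C_r(\overline{\mathcal{O}_{\mathrm{sub}}})$. Moreover, $\mathrm{codim}\, C_r^{\mathrm{sing}}\ge 2$, where the codimension is taken in $C_r(\mathcal{N})$.
   Context: For a closed subvariety $V\subseteq\mathfrak{sl}_3$, $C_r(V)=\{(v_1,\ldots,v_r)\in V^r\mid [v_i,v_j]=0\text{ for all }i,j\}$ with reduced structure. $\mathcal{O}_{\mathrm{sub}}$ is the $SL_3$-orbit (under the adjoint action) consisting of all nilpotent $3\times 3$ matrices of rank one, and $\overline{\mathcal{O}_{\mathrm{sub}}}=\mathcal{O}_{\mathrm{sub}}\cup\{0\}$. *)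

theory Defs
  imports "HOL-Analysis.Analysis" "HOL-Library.Poly_Mapping" "HOL-Computational_Algebra.Polynomial"
begin

section \<open>Affine space with the Zariski topology\<close>

text \<open>
  A polynomial with coefficients in \<open>'k\<close> and variables indexed by \<open>'n\<close> maps finitely many monomials
  (finitely supported exponent functions) to their coefficients; affine space is \<open>'k ^ 'n\<close>.
\<close>

type_synonym ('n, 'k) mvpoly = "('n \<Rightarrow>\<^sub>0 nat) \<Rightarrow>\<^sub>0 'k"

definition mveval :: "('n::finite, 'k::comm_ring_1) mvpoly \<Rightarrow> 'k ^ 'n \<Rightarrow> 'k" where
  "mveval f x = (\<Sum>m\<in>Poly_Mapping.keys f.
     Poly_Mapping.lookup f m * (\<Prod>i\<in>UNIV. x $ i ^ Poly_Mapping.lookup m i))"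

text \<open>The formal partial derivative with respect to the variable \<open>i\<close>.\<close>

definition mvpderiv :: "'n \<Rightarrow> ('n::finite, 'k::comm_ring_1) mvpoly \<Rightarrow> ('n, 'k) mvpoly" where
  "mvpderiv i f = (\<Sum>m\<in>Poly_Mapping.keys f.
     Poly_Mapping.single (m - Poly_Mapping.single i 1)
       (of_nat (Poly_Mapping.lookup m i) * Poly_Mapping.lookup f m))"

definition zero_locus :: "('n::finite, 'k::comm_ring_1) mvpoly set \<Rightarrow> ('k ^ 'n) set" where
  "zero_locus S = {x. \<forall>f\<in>S. mveval f x = 0}"

definition vanishing_ideal :: "('k::comm_ring_1 ^ 'n::finite) set \<Rightarrow> ('n, 'k) mvpoly set" where
  "vanishing_ideal X = {f. \<forall>x\<in>X. mveval f x = 0}"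

definition zariski :: "('k::idom ^ 'n::finite) topology" where
  "zariski = topology (\<lambda>U. \<exists>S. - U = zero_locus S)"

lemma mveval_superset:
  assumes "finite M" "Poly_Mapping.keys f \<subseteq> M"
  shows "mveval f x = (\<Sum>m\<in>M. Poly_Mapping.lookup f m * (\<Prod>i\<in>UNIV. x $ i ^ Poly_Mapping.lookup m i))"
  unfolding mveval_def
  by (rule sum.mono_neutral_left) (use assms in \<open>auto simp: in_keys_iff\<close>)

lemma mveval_zero [simp]: "mveval 0 x = 0"
  by (simp add: mveval_def)

lemma mveval_add: "mveval (f + g) x = mveval f x + mveval g x"
proof -
  let ?M = "Poly_Mapping.keys f \<union> Poly_Mapping.keys g"
  have "Poly_Mapping.keys (f + g) \<subseteq> ?M"
    by (rule Poly_Mapping.keys_add)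
  then show ?thesis
    by (simp add: mveval_superset[of ?M] lookup_add distrib_right sum.distrib)
qed

lemma mveval_sum: "mveval (\<Sum>a\<in>A. F a) x = (\<Sum>a\<in>A. mveval (F a) x)"
  by (induction A rule: infinite_finite_induct) (auto simp: mveval_add)

lemma mveval_single:
  "mveval (Poly_Mapping.single m c) x = c * (\<Prod>i\<in>UNIV. x $ i ^ Poly_Mapping.lookup m i)"
  by (simp add: mveval_superset[of "{m}"])

lemma mveval_one: "mveval 1 x = 1"
  using mveval_single[of 0 1 x] by simp

lemma mvpoly_sum_monomials:
  "f = (\<Sum>m\<in>Poly_Mapping.keys f. Poly_Mapping.single m (Poly_Mapping.lookup f m))"
  by (rule poly_mapping_eqI)
    (auto simp: lookup_sum lookup_single when_def sum.delta in_keys_iff)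

lemma mveval_mult: "mveval (f * g) x = mveval f x * mveval g x"
proof -
  let ?s = "\<lambda>f m. Poly_Mapping.single m (Poly_Mapping.lookup f m)"
  have "f * g = (\<Sum>m\<in>Poly_Mapping.keys f. ?s f m) * (\<Sum>m\<in>Poly_Mapping.keys g. ?s g m)"
    using mvpoly_sum_monomials[of f] mvpoly_sum_monomials[of g] by simp
  also have "mveval \<dots> x = mveval f x * mveval g x"
    unfolding sum_product mveval_sum mult_single mveval_single mveval_def[of f] mveval_def[of g]
    by (simp add: lookup_add power_add prod.distrib mult_ac)
  finally show ?thesis .
qed

lemma istopology_zariski:
  "istopology (\<lambda>U. \<exists>S :: ('n::finite, 'k::idom) mvpoly set. - U = zero_locus S)"
  unfolding istopology_def
proof (intro conjI allI impI)
  fix U V :: "('k ^ 'n) set"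
  assume "\<exists>S :: ('n, 'k) mvpoly set. - U = zero_locus S"
    and "\<exists>S :: ('n, 'k) mvpoly set. - V = zero_locus S"
  then obtain S T :: "('n, 'k) mvpoly set" where ST: "- U = zero_locus S" "- V = zero_locus T"
    by blast
  have "zero_locus {f * g |f g. f \<in> S \<and> g \<in> T} = zero_locus S \<union> zero_locus T"
    by (auto simp: zero_locus_def mveval_mult) (metis mult_eq_0_iff mveval_mult)
  then have "- (U \<inter> V) = zero_locus {f * g |f g. f \<in> S \<and> g \<in> T}"
    using ST by auto
  then show "\<exists>S :: ('n, 'k) mvpoly set. - (U \<inter> V) = zero_locus S"
    by blast
next
  fix \<U> :: "('k ^ 'n) set set"
  assume "\<forall>U\<in>\<U>. \<exists>S :: ('n, 'k) mvpoly set. - U = zero_locus S"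
  then obtain F :: "('k ^ 'n) set \<Rightarrow> ('n, 'k) mvpoly set"
    where F: "\<forall>U\<in>\<U>. - U = zero_locus (F U)"
    by metis
  have "- \<Union>\<U> = (\<Inter>U\<in>\<U>. - U)"
    by auto
  also have "\<dots> = zero_locus (\<Union>U\<in>\<U>. F U)"
    using F by (auto simp: zero_locus_def)
  finally show "\<exists>S :: ('n, 'k) mvpoly set. - \<Union>\<U> = zero_locus S"
    by blast
qed

lemma openin_zariski:
  "openin zariski (U :: ('k::idom ^ 'n::finite) set) \<longleftrightarrow> (\<exists>S. - U = zero_locus S)"
  unfolding zariski_def by (simp add: topology_inverse'[OF istopology_zariski])

lemma topspace_zariski [simp]: "topspace (zariski :: ('k::idom ^ 'n::finite) topology) = UNIV"
proof -
  have "- UNIV = zero_locus {1 :: ('n, 'k) mvpoly}"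
    by (simp add: zero_locus_def mveval_one)
  then have "openin zariski (UNIV :: ('k ^ 'n) set)"
    unfolding openin_zariski by blast
  then show ?thesis
    by (metis openin_subset top.extremum_uniqueI)
qed

lemma closedin_zariski:
  "closedin zariski (X :: ('k::idom ^ 'n::finite) set) \<longleftrightarrow> (\<exists>S. X = zero_locus S)"
  by (simp add: closedin_def openin_zariski Compl_eq_Diff_UNIV double_diff)


section \<open>Dimension and codimension\<close>

definition irreducible_closed :: "'a topology \<Rightarrow> 'a set \<Rightarrow> bool" where
  "irreducible_closed T Z \<longleftrightarrow> closedin T Z \<and> Z \<noteq> {} \<and>
     (\<forall>A B. closedin T A \<and> closedin T B \<and> Z = A \<union> B \<longrightarrow> Z = A \<or> Z = B)"

text \<open>
  The codimension of an irreducible closed \<open>Z\<close> is the supremum of the lengths \<open>n\<close> of chains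
  \<open>Z = Z\<^sub>0 \<subset> Z\<^sub>1 \<subset> \<dots> \<subset> Z\<^sub>n\<close> of irreducible closed subsets of the whole space. For an arbitrary closed
  \<open>Y\<close> one takes the infimum over the irreducible closed subsets of \<open>Y\<close> (so \<open>\<infinity>\<close> for \<open>Y = {}\<close>).
\<close>

definition codim_irreducible :: "'a topology \<Rightarrow> 'a set \<Rightarrow> enat" where
  "codim_irreducible T Z = Sup {enat n |n. \<exists>C :: nat \<Rightarrow> 'a set. C 0 = Z \<and>
     (\<forall>i\<le>n. irreducible_closed T (C i)) \<and> (\<forall>i<n. C i \<subset> C (Suc i))}"

definition codim :: "'a topology \<Rightarrow> 'a set \<Rightarrow> enat" where
  "codim T Y = Inf {codim_irreducible T Z |Z. irreducible_closed T Z \<and> Z \<subseteq> Y}"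

text \<open>
  The local dimension of \<open>X\<close> at \<open>x\<close>, i.e.\ the Krull dimension of the local ring of \<open>X\<close> at \<open>x\<close>:
  prime ideals of that ring correspond to the irreducible closed subsets of \<open>X\<close> containing \<open>x\<close>.
\<close>

definition local_dim :: "('k::idom ^ 'n::finite) set \<Rightarrow> 'k ^ 'n \<Rightarrow> enat" where
  "local_dim X x = Sup {enat n |n. \<exists>C :: nat \<Rightarrow> ('k ^ 'n) set. x \<in> C 0 \<and>
     (\<forall>i\<le>n. irreducible_closed (subtopology zariski X) (C i)) \<and> (\<forall>i<n. C i \<subset> C (Suc i))}"


section \<open>Singular locus\<close>

text \<open>
  The Zariski tangent space of \<open>X\<close> with its reduced structure: all polynomials vanishing on \<open>X\<close>
  are used, not just some chosen set of defining equations.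
\<close>

definition tangent_space :: "('k::field ^ 'n::finite) set \<Rightarrow> 'k ^ 'n \<Rightarrow> ('k ^ 'n) set" where
  "tangent_space X x =
     {u. \<forall>f\<in>vanishing_ideal X. (\<Sum>i\<in>UNIV. mveval (mvpderiv i f) x * u $ i) = 0}"

definition singular_locus :: "('k::field ^ 'n::finite) set \<Rightarrow> ('k ^ 'n) set" where
  "singular_locus X = {x\<in>X. enat (vec.dim (tangent_space X x)) \<noteq> local_dim X x}"


section \<open>Commuting varieties over the nilpotent cone\<close>

text \<open>
  Matrices are points of the affine space with coordinates indexed by \<open>3 \<times> 3\<close>, and tuples of
  matrices are points of the affine space with coordinates indexed by \<open>'r \<times> 3 \<times> 3\<close>, where
  \<open>'r\<close> is a nonempty finite index type. The power \<open>A ^ m\<close> on \<open>'k ^ 3 ^ 3\<close> is componentwise, hence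
  the iterated matrix product in the definition of nilpotency.
\<close>

definition to_matrix :: "'k ^ ('m::finite \<times> 'n::finite) \<Rightarrow> 'k ^ 'n ^ 'm" where
  "to_matrix a = (\<chi> i j. a $ (i, j))"

definition component :: "'k ^ ('r::finite \<times> 'm::finite) \<Rightarrow> 'r \<Rightarrow> 'k ^ 'm" where
  "component v i = (\<chi> p. v $ (i, p))"

definition nilpotent_matrix :: "'k::comm_ring_1 ^ 'n ^ 'n \<Rightarrow> bool" where
  "nilpotent_matrix A \<longleftrightarrow> (\<exists>m. (((**) A) ^^ m) (mat 1) = mat 0)"

definition sl3 :: "('k::field ^ (3 \<times> 3)) set" where
  "sl3 = {a. trace (to_matrix a) = 0}"

definition nilpotent_cone :: "('k::field ^ (3 \<times> 3)) set" where
  "nilpotent_cone = {a\<in>sl3. nilpotent_matrix (to_matrix a)}"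

definition subregular_orbit :: "('k::field ^ (3 \<times> 3)) set" where
  "subregular_orbit = {a\<in>nilpotent_cone. rank (to_matrix a) = 1}"

definition subregular_closure :: "('k::field ^ (3 \<times> 3)) set" where
  "subregular_closure = subtopology zariski nilpotent_cone closure_of subregular_orbit"

definition commuting_variety ::
    "('k::field ^ (3 \<times> 3)) set \<Rightarrow> ('k ^ ('r::finite \<times> 3 \<times> 3)) set" where
  "commuting_variety V = {v. (\<forall>i. component v i \<in> V) \<and>
     (\<forall>i j. to_matrix (component v i) ** to_matrix (component v j)
          - to_matrix (component v j) ** to_matrix (component v i) = 0)}"

end

theory Submission
  imports Defs
begin

text \<open>
  Over a commuting tuple of nilpotent matrices there is a full flag \<open>H\<close> in which the \<open>i\<close>-th matrix is
  strictly upper triangular with entries \<open>a\<^sub>i s\<close>, \<open>a\<^sub>i t\<close>, \<open>b\<^sub>i\<close>. Hence the commuting variety is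
  the image of an affine space; it is irreducible, and the flags in the big cell with \<open>s = 1\<close> give
  a dense image of an affine space of dimension \<open>2r + 4\<close>, which bounds the length of all chains.

  If some component is regular, conjugation makes it a Jordan block and the others polynomials in
  it. At such a point a chain of length \<open>2r + 4\<close> is obtained by freeing the parameters one by one, and the
  linearizations of \<open>x\<^sub>i x\<^sub>j = x\<^sub>j x\<^sub>i\<close> and \<open>x\<^sub>i x\<^sub>j x\<^sub>l = 0\<close> cut the tangent space down to
  dimension \<open>2r + 4\<close>, a dimension that velocities of curves attain. (Traces do not suffice for this
  in characteristics two and three.) So singular tuples consist of square-zero matrices.

  Such tuples share an image line or a kernel plane. Those with a common image line deform, by
  bending the matrices towards flags whose plane contains a fixed vector, within an irreducible family
  that is strictly larger and still not dense; transposition handles a common kernel plane.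
\<close>

text \<open>Dimension and codimension are suprema of lengths of chains, so each value is pinned from
  two sides. From below there are explicit chains of closures of families whose members are joined
  by polynomial curves, namely by straight segments in the parameters; such segments may cross
  singular \<open>H\<close>, which \<open>adj3 H\<close> tolerates. From above there is a count of
  monomials. The number 2r + 4 is 3 for the full flag, 1 for the ratio t : s, and 2r for the
  coefficients \<open>a\<close> and \<open>b\<close>.

  Tuples with a common image line have 2 + 2r parameters, the line and r functionals vanishing on
  it. This is two less than the total and leaves room for a single irreducible closed set in
  between, which is why one extra bending parameter is added; its non-density and its strictness are
  both read off the squares of the matrices. Velocities are linear coefficients of polynomials,
  which makes sense in every characteristic.\<close>

lemma infinite_UNIV_alg_closed: "infinite (UNIV :: 'k::alg_closed_field set)"
proof
  assume fin: "finite (UNIV :: 'k set)"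
  let ?q = "\<Prod>a\<in>(UNIV :: 'k set). [:-a, 1:]"
  have q0: "poly ?q x = 0" for x :: 'k
    using fin by (auto simp: poly_prod intro!: prod_zero)
  have "degree ?q > 0"
  proof (rule ccontr)
    assume "\<not> degree ?q > 0"
    then obtain c where c: "?q = [:c:]" by (metis degree_eq_zeroE gr0I)
    then have "c = 0" using q0[of 0] by simp
    then have "?q = 0" using c by simp
    moreover have "?q \<noteq> 0" using fin by simp
    ultimately show False by simp
  qed
  then have "degree (?q + 1) > 0"
    by (simp add: degree_add_eq_left)
  then obtain x where "poly (?q + 1) x = 0"
    using alg_closed_imp_poly_has_root by blast
  then show False using q0[of x] by simp
qed

lemma poly_eq_0_infinite:
  fixes p :: "'k::idom poly"
  assumes "infinite {x. poly p x = 0}"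
  shows "p = 0"
  using assms poly_roots_finite by blast

section \<open>Polynomial functions and polynomial curves\<close>

definition polyfun :: "('k::comm_ring_1 ^ 'n::finite \<Rightarrow> 'k) \<Rightarrow> bool" where
  "polyfun h \<longleftrightarrow> (\<exists>f. h = mveval f)"

lemma polyfunI: "(\<And>x. h x = mveval f x) \<Longrightarrow> polyfun h"
  unfolding polyfun_def by blast

lemma polyfun_mveval: "polyfun (mveval f)"
  unfolding polyfun_def by blast

lemma polyfun_const: "polyfun (\<lambda>x. c)"
  by (rule polyfunI[where f = "Poly_Mapping.single 0 c"]) (simp add: mveval_single)

lemma polyfun_coord: "polyfun (\<lambda>x. x $ i)"
proof (rule polyfunI[where f = "Poly_Mapping.single (Poly_Mapping.single i 1) 1"])
  fix x :: "'a ^ 'b"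
  have "(\<Prod>j\<in>UNIV. x $ j ^ Poly_Mapping.lookup (Poly_Mapping.single i (1::nat)) j) =
        (\<Prod>j\<in>UNIV. if j = i then x $ j else 1)"
    by (intro prod.cong) (auto simp: lookup_single when_def)
  then show "x $ i = mveval (Poly_Mapping.single (Poly_Mapping.single i 1) 1) x"
    by (simp add: mveval_single)
qed

lemma polyfun_add: "polyfun f \<Longrightarrow> polyfun g \<Longrightarrow> polyfun (\<lambda>x. f x + g x)"
proof -
  assume "polyfun f" "polyfun g"
  then obtain p q where "f = mveval p" "g = mveval q" unfolding polyfun_def by blast
  then show ?thesis by (intro polyfunI[of _ "p + q"]) (simp add: mveval_add)
qed

lemma polyfun_mult: "polyfun f \<Longrightarrow> polyfun g \<Longrightarrow> polyfun (\<lambda>x. f x * g x)"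
proof -
  assume "polyfun f" "polyfun g"
  then obtain p q where "f = mveval p" "g = mveval q" unfolding polyfun_def by blast
  then show ?thesis by (intro polyfunI[of _ "p * q"]) (simp add: mveval_mult)
qed

lemma polyfun_uminus: "polyfun f \<Longrightarrow> polyfun (\<lambda>x. - f x)"
  using polyfun_mult[OF polyfun_const[of "-1"]] by simp

lemma polyfun_diff: "polyfun f \<Longrightarrow> polyfun g \<Longrightarrow> polyfun (\<lambda>x. f x - g x)"
  using polyfun_add[OF _ polyfun_uminus, of f g] by simp

lemma polyfun_sum: "(\<And>a. a \<in> A \<Longrightarrow> polyfun (F a)) \<Longrightarrow> polyfun (\<lambda>x. \<Sum>a\<in>A. F a x)"
  by (induction A rule: infinite_finite_induct) (auto intro: polyfun_add polyfun_const)

lemma polyfun_prod: "(\<And>a. a \<in> A \<Longrightarrow> polyfun (F a)) \<Longrightarrow> polyfun (\<lambda>x. \<Prod>a\<in>A. F a x)"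
  by (induction A rule: infinite_finite_induct) (auto intro: polyfun_mult polyfun_const)

lemma polyfun_power: "polyfun f \<Longrightarrow> polyfun (\<lambda>x. f x ^ n)"
  by (induction n) (auto intro: polyfun_mult polyfun_const)

lemma polyfun_comp:
  assumes "polyfun h" "\<And>i. polyfun (\<lambda>x. g x $ i)"
  shows "polyfun (\<lambda>x. h (g x))"
proof -
  obtain f where "h = mveval f" using assms(1) polyfun_def by blast
  then show ?thesis
    unfolding mveval_def using assms(2)
    by (auto intro!: polyfun_sum polyfun_mult polyfun_const polyfun_prod polyfun_power)
qed

section \<open>Polynomial functions on the line and their derivatives at 0\<close>

definition polyvel :: "('k::comm_ring_1 \<Rightarrow> 'k) \<Rightarrow> 'k \<Rightarrow> bool" where
  "polyvel h d \<longleftrightarrow> (\<exists>p. h = poly p \<and> coeff p 1 = d)"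

definition poly1 :: "('k::comm_ring_1 \<Rightarrow> 'k) \<Rightarrow> bool" where
  "poly1 h \<longleftrightarrow> (\<exists>p. h = poly p)"

lemma poly1I: "polyvel h d \<Longrightarrow> poly1 h"
  unfolding poly1_def polyvel_def by blast

lemma poly1D: "poly1 h \<Longrightarrow> \<exists>d. polyvel h d"
  unfolding poly1_def polyvel_def by blast

lemma polyvel_const: "polyvel (\<lambda>x. c) 0"
  unfolding polyvel_def by (rule exI[of _ "[:c:]"]) auto

lemma polyvel_id: "polyvel (\<lambda>x. x) 1"
  unfolding polyvel_def by (rule exI[of _ "[:0, 1:]"]) auto

lemma polyvel_add: "polyvel f d \<Longrightarrow> polyvel g e \<Longrightarrow> polyvel (\<lambda>x. f x + g x) (d + e)"
proof -
  assume "polyvel f d" "polyvel g e"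
  then obtain p q where "f = poly p" "g = poly q" "coeff p 1 = d" "coeff q 1 = e"
    unfolding polyvel_def by metis
  then show ?thesis unfolding polyvel_def by (intro exI[of _ "p + q"]) auto
qed

lemma polyvel_mult:
  assumes "polyvel f d" "polyvel g e"
  shows "polyvel (\<lambda>x. f x * g x) (f 0 * e + d * g 0)"
proof -
  obtain p q where p: "f = poly p" "coeff p 1 = d" and q: "g = poly q" "coeff q 1 = e"
    using assms unfolding polyvel_def by blast
  have "coeff (p * q) 1 = f 0 * e + d * g 0"
    using p q by (simp add: coeff_mult poly_0_coeff_0)
  then show ?thesis
    unfolding polyvel_def using p q by (intro exI[of _ "p * q"]) auto
qed

lemma polyvel_cong: "polyvel f d \<Longrightarrow> d = e \<Longrightarrow> polyvel f e"
  by simp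

lemma polyvel_uminus: "polyvel f d \<Longrightarrow> polyvel (\<lambda>x. - f x) (- d)"
  using polyvel_mult[OF polyvel_const[of "-1"], of f d] by simp

lemma polyvel_diff: "polyvel f d \<Longrightarrow> polyvel g e \<Longrightarrow> polyvel (\<lambda>x. f x - g x) (d - e)"
  using polyvel_add[OF _ polyvel_uminus, of f d g e] by simp

lemma polyvel_sum:
  "(\<And>a. a \<in> A \<Longrightarrow> polyvel (F a) (d a)) \<Longrightarrow> polyvel (\<lambda>x. \<Sum>a\<in>A. F a x) (\<Sum>a\<in>A. d a)"
  by (induction A rule: infinite_finite_induct) (auto intro: polyvel_add polyvel_const)

lemma polyvel_power:
  "polyvel f d \<Longrightarrow> polyvel (\<lambda>x. f x ^ n) (of_nat n * f 0 ^ (n - 1) * d)"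
proof (induction n)
  case (Suc n)
  show ?case
    by (rule polyvel_cong, simp, rule polyvel_mult[OF Suc.prems Suc.IH[OF Suc.prems]])
      (cases n; simp add: algebra_simps)
qed (use polyvel_const in auto)

lemma polyvel_prod:
  "finite A \<Longrightarrow> (\<And>a. a \<in> A \<Longrightarrow> polyvel (F a) (d a)) \<Longrightarrow>
    polyvel (\<lambda>x. \<Prod>a\<in>A. F a x) (\<Sum>a\<in>A. d a * (\<Prod>b\<in>A - {a}. F b 0))"
proof (induction A rule: finite_induct)
  case (insert a A)
  have "polyvel (\<lambda>x. F a x * (\<Prod>b\<in>A. F b x))
      (F a 0 * (\<Sum>c\<in>A. d c * (\<Prod>b\<in>A - {c}. F b 0)) + d a * (\<Prod>b\<in>A. F b 0))"
    by (rule polyvel_mult) (use insert in auto)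
  moreover have "(\<Prod>b\<in>insert a A - {c}. F b 0) = F a 0 * (\<Prod>b\<in>A - {c}. F b 0)" if "c \<in> A" for c
  proof -
    have "insert a A - {c} = insert a (A - {c})" using that insert by auto
    then show ?thesis using insert by simp
  qed
  moreover have "insert a A - {a} = A" using insert by auto
  ultimately show ?case
    using insert by (simp add: sum_distrib_left mult_ac add_ac cong: sum.cong)
qed (use polyvel_const in auto)

text \<open>Polynomials inducing the same function agree because the field is infinite, so the
  velocity belongs to the function and not to the polynomial chosen for it.\<close>

lemma polyvel_unique:
  fixes h :: "'k::alg_closed_field \<Rightarrow> 'k"
  assumes "polyvel h d" "polyvel h e"
  shows "d = e"
proof -
  obtain p q where "h = poly p" "h = poly q" "coeff p 1 = d" "coeff q 1 = e"
    using assms unfolding polyvel_def by metis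
  moreover have "p = q"
    using poly_eq_0_infinite[of "p - q"] infinite_UNIV_alg_closed[where 'k = 'k] calculation(1,2)
    by simp
  ultimately show ?thesis by simp
qed

lemma poly1_const: "poly1 (\<lambda>x. c)"
  and poly1_id: "poly1 (\<lambda>x. x)"
  by (blast intro: poly1I polyvel_const polyvel_id)+

lemma poly1_add: "poly1 f \<Longrightarrow> poly1 g \<Longrightarrow> poly1 (\<lambda>x. f x + g x)"
  and poly1_diff: "poly1 f \<Longrightarrow> poly1 g \<Longrightarrow> poly1 (\<lambda>x. f x - g x)"
  and poly1_mult: "poly1 f \<Longrightarrow> poly1 g \<Longrightarrow> poly1 (\<lambda>x. f x * g x)"
  by (auto dest!: poly1D intro: poly1I polyvel_add polyvel_diff polyvel_mult)

lemma poly1_uminus: "poly1 f \<Longrightarrow> poly1 (\<lambda>x. - f x)"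
  by (auto dest!: poly1D intro: poly1I polyvel_uminus)

lemma poly1_sum: "(\<And>a. a \<in> A \<Longrightarrow> poly1 (F a)) \<Longrightarrow> poly1 (\<lambda>x. \<Sum>a\<in>A. F a x)"
  by (induction A rule: infinite_finite_induct) (auto intro: poly1_add poly1_const)

lemmas poly1_intros = poly1_const poly1_id poly1_add poly1_diff poly1_mult poly1_uminus poly1_sum

text \<open>This is the chain rule for formal partial derivatives. The truncated exponent in
  \<open>mvpderiv\<close> is harmless, since a variable of exponent 0 contributes the factor
  0.\<close>

lemma polyvel_mveval:
  fixes f :: "('n::finite, 'k::comm_ring_1) mvpoly"
  assumes "\<And>i. polyvel (\<lambda>t. c t $ i) (w $ i)"
  shows "polyvel (\<lambda>t. mveval f (c t)) (\<Sum>i\<in>UNIV. mveval (mvpderiv i f) (c 0) * w $ i)"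
proof -
  let ?l = "Poly_Mapping.lookup"
  have split: "(\<Prod>j\<in>UNIV. c 0 $ j ^ ?l (m - Poly_Mapping.single i 1) j) =
      c 0 $ i ^ (?l m i - 1) * (\<Prod>j\<in>UNIV - {i}. c 0 $ j ^ ?l m j)" for m i
  proof -
    have "(\<Prod>j\<in>UNIV. c 0 $ j ^ ?l (m - Poly_Mapping.single i 1) j) =
      c 0 $ i ^ ?l (m - Poly_Mapping.single i 1) i * (\<Prod>j\<in>UNIV - {i}. c 0 $ j ^ ?l (m - Poly_Mapping.single i 1) j)"
      by (simp add: prod.remove[of UNIV i])
    moreover have "(\<Prod>j\<in>UNIV - {i}. c 0 $ j ^ ?l (m - Poly_Mapping.single i 1) j) =
       (\<Prod>j\<in>UNIV - {i}. c 0 $ j ^ ?l m j)"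
      by (intro prod.cong) (auto simp: lookup_minus lookup_single when_def)
    ultimately show ?thesis by (simp add: lookup_minus)
  qed
  have "polyvel (\<lambda>t. mveval f (c t)) (\<Sum>m\<in>Poly_Mapping.keys f. ?l f m *
     (\<Sum>i\<in>UNIV. of_nat (?l m i) * c 0 $ i ^ (?l m i - 1) * w $ i *
        (\<Prod>j\<in>UNIV - {i}. c 0 $ j ^ ?l m j)))"
    unfolding mveval_def
  proof (rule polyvel_sum)
    fix m
    show "polyvel (\<lambda>t. ?l f m * (\<Prod>i\<in>UNIV. c t $ i ^ ?l m i))
        (?l f m * (\<Sum>i\<in>UNIV. of_nat (?l m i) * c 0 $ i ^ (?l m i - 1) * w $ i *
        (\<Prod>j\<in>UNIV - {i}. c 0 $ j ^ ?l m j)))"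
      by (rule polyvel_cong, rule polyvel_mult, rule polyvel_const, rule polyvel_prod, simp,
          rule polyvel_power, rule assms) simp
  qed
  moreover have "(\<Sum>i\<in>UNIV. mveval (mvpderiv i f) (c 0) * w $ i) = (\<Sum>i\<in>UNIV. \<Sum>m\<in>Poly_Mapping.keys f.
      ?l f m * (of_nat (?l m i) * c 0 $ i ^ (?l m i - 1) * w $ i * (\<Prod>j\<in>UNIV - {i}. c 0 $ j ^ ?l m j)))"
    unfolding mvpderiv_def mveval_sum mveval_single split
    by (simp add: sum_distrib_left sum_distrib_right mult_ac)
  ultimately show ?thesis
    by (simp add: sum_distrib_left sum.swap[of _ UNIV])
qed

lemma poly1_polyfun:
  assumes "polyfun h" "\<And>i. poly1 (\<lambda>t. c t $ i)"
  shows "poly1 (\<lambda>t. h (c t))"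
proof -
  obtain f where f: "h = mveval f" using assms(1) polyfun_def by blast
  obtain w where "\<And>i. polyvel (\<lambda>t. c t $ i) (w i)"
    using poly1D[OF assms(2)] by metis
  then show ?thesis
    using polyvel_mveval[of c "\<chi> i. w i" f] f by (auto intro: poly1I)
qed

section \<open>Irreducible closed sets\<close>

abbreviation zar :: "('k::idom ^ 'n::finite) set \<Rightarrow> ('k ^ 'n) topology" where
  "zar X \<equiv> subtopology zariski X"

lemma closedin_zar:
  "closedin (zar X) Z \<longleftrightarrow> (\<exists>S. Z = X \<inter> zero_locus S)"
  unfolding closedin_subtopology closedin_zariski by auto

lemma closedin_zar_vanishing: "polyfun h \<Longrightarrow> closedin (zar X) {x\<in>X. h x = 0}"
proof -
  assume "polyfun h"
  then obtain f where f: "h = mveval f" using polyfun_def by blast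
  have "{x\<in>X. h x = 0} = X \<inter> zero_locus {f}" by (auto simp: zero_locus_def f)
  then show ?thesis using closedin_zar by blast
qed

lemma closed_separating_polyfun:
  assumes "closedin (zar X) Z" "x \<in> X" "x \<notin> Z"
  obtains h where "polyfun h" "\<And>z. z \<in> Z \<Longrightarrow> h z = 0" "h x \<noteq> 0"
proof -
  obtain S where S: "Z = X \<inter> zero_locus S" using assms(1) closedin_zar by blast
  then obtain f where "f \<in> S" "mveval f x \<noteq> 0" using assms(2,3) by (auto simp: zero_locus_def)
  then show thesis using that[OF polyfun_mveval, of f] S by (auto simp: zero_locus_def)
qed

lemma polyfun_vanishes_closure_of:
  assumes "polyfun h" "\<And>x. x \<in> S \<Longrightarrow> h x = 0" "x \<in> zar X closure_of S"
  shows "h x = 0"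
proof -
  have "zar X closure_of S = zar X closure_of (X \<inter> S)"
    using closure_of_restrict[of "zar X" S] by simp
  also have "\<dots> \<subseteq> {x\<in>X. h x = 0}"
    by (rule closure_of_minimal[OF _ closedin_zar_vanishing[OF assms(1)]]) (use assms(2) in auto)
  finally show ?thesis using assms(3) by auto
qed

lemma closure_of_psubset:
  assumes "S \<subseteq> S'" "polyfun h" "\<And>x. x \<in> S \<Longrightarrow> h x = 0" "v \<in> S'" "v \<in> X" "h v \<noteq> 0"
  shows "zar X closure_of S \<subset> zar X closure_of S'"
proof
  show "zar X closure_of S \<subseteq> zar X closure_of S'" by (rule closure_of_mono[OF assms(1)])
  have "v \<in> zar X closure_of S'"
    using closure_of_subset_Int[of "zar X" S'] assms(4,5) by auto
  moreover have "v \<notin> zar X closure_of S"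
    using polyfun_vanishes_closure_of[OF assms(2,3)] assms(6) by blast
  ultimately show "zar X closure_of S \<noteq> zar X closure_of S'" by blast
qed

definition polycurve :: "('k::comm_ring_1 \<Rightarrow> 'k ^ 'n::finite) \<Rightarrow> bool" where
  "polycurve c \<longleftrightarrow> (\<forall>i. poly1 (\<lambda>t. c t $ i))"

lemma polycurve_polyfun: "polycurve c \<Longrightarrow> polyfun h \<Longrightarrow> poly1 (\<lambda>t. h (c t))"
  unfolding polycurve_def using poly1_polyfun by blast

definition poly_connected :: "('k::comm_ring_1 ^ 'n::finite) set \<Rightarrow> bool" where
  "poly_connected S \<longleftrightarrow> S \<noteq> {} \<and>
    (\<forall>a\<in>S. \<forall>b\<in>S. \<exists>c. polycurve c \<and> range c \<subseteq> S \<and> c 0 = a \<and> c 1 = b)"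

text \<open>Polynomials have no zero divisors, and over an infinite field this passes to functions.
  Besides irreducibility it yields limits: what holds wherever \<open>g\<close> is nonzero holds at
  the exceptional parameters too.\<close>

lemma poly1_cover:
  fixes f g :: "'k::alg_closed_field \<Rightarrow> 'k"
  assumes "poly1 f" "poly1 g" "\<And>t. f t * g t = 0" "g b \<noteq> 0"
  shows "f t = 0"
proof -
  obtain p q where pq: "f = poly p" "g = poly q" using assms(1,2) poly1_def by metis
  have "p * q = 0"
    by (rule poly_eq_0_infinite) (use assms(3) pq infinite_UNIV_alg_closed[where 'k = 'k] in simp)
  moreover have "q \<noteq> 0" using assms(4) pq by auto
  ultimately show ?thesis using pq by simp
qed

text \<open>
  A polynomial curve joining points outside two closed sets is not covered by them, because its
  parameter line is irreducible.
\<close>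

lemma irreducible_closure_of_poly_connected:
  fixes S :: "('k::alg_closed_field ^ 'n::finite) set"
  assumes "poly_connected S" "S \<subseteq> X"
  shows "irreducible_closed (zar X) (zar X closure_of S)"
  unfolding irreducible_closed_def
proof (intro conjI allI impI)
  have sub: "S \<subseteq> zar X closure_of S" using assms(2) by (simp add: closure_of_subset)
  moreover have "S \<noteq> {}" using assms(1) by (simp add: poly_connected_def)
  ultimately show "zar X closure_of S \<noteq> {}" by auto
  show "closedin (zar X) (zar X closure_of S)" by simp
  fix A B
  assume "closedin (zar X) A \<and> closedin (zar X) B \<and> zar X closure_of S = A \<union> B"
  then have A: "closedin (zar X) A" and B: "closedin (zar X) B" and AB: "zar X closure_of S = A \<union> B"
    by auto
  have "S \<subseteq> A \<or> S \<subseteq> B"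
  proof (rule ccontr)
    assume "\<not> (S \<subseteq> A \<or> S \<subseteq> B)"
    then obtain a b where ab: "a \<in> S" "a \<notin> A" "b \<in> S" "b \<notin> B" by blast
    obtain f where f: "polyfun f" "\<And>z. z \<in> A \<Longrightarrow> f z = 0" "f a \<noteq> 0"
      using closed_separating_polyfun[OF A] ab assms(2) by blast
    obtain g where g: "polyfun g" "\<And>z. z \<in> B \<Longrightarrow> g z = 0" "g b \<noteq> 0"
      using closed_separating_polyfun[OF B] ab assms(2) by blast
    obtain c where c: "polycurve c" "range c \<subseteq> S" "c 0 = a" "c 1 = b"
      using assms(1) ab unfolding poly_connected_def by metis
    have "f (c t) * g (c t) = 0" for t
    proof -
      have "c t \<in> A \<union> B" using c(2) sub AB by blast
      then show ?thesis using f(2) g(2) by auto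
    qed
    then have "f (c 0) = 0"
      using poly1_cover[OF polycurve_polyfun[OF c(1) f(1)] polycurve_polyfun[OF c(1) g(1)], of 1 0]
        g(3) c(4) by simp
    then show False using f(3) c(3) by simp
  qed
  then show "zar X closure_of S = A \<or> zar X closure_of S = B"
    using closure_of_minimal[OF _ A] closure_of_minimal[OF _ B] AB by blast
qed

lemma irreducible_closed_subset_Un:
  assumes "irreducible_closed T Z" "closedin T A" "closedin T B" "Z \<subseteq> A \<union> B"
  shows "Z \<subseteq> A \<or> Z \<subseteq> B"
proof -
  have "closedin T Z" and irr: "\<And>A B. closedin T A \<Longrightarrow> closedin T B \<Longrightarrow> Z = A \<union> B \<Longrightarrow> Z = A \<or> Z = B"
    using assms(1) unfolding irreducible_closed_def by blast+
  then have "closedin T (Z \<inter> A)" "closedin T (Z \<inter> B)" "Z = (Z \<inter> A) \<union> (Z \<inter> B)"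
    using assms(2-4) by auto
  then show ?thesis using irr by blast
qed

text \<open>The coordinate ring of an irreducible closed set is a domain, so a factor not
  identically zero on \<open>Z\<close> can be cancelled.\<close>

lemma irreducible_closed_mult_eq_0:
  assumes "irreducible_closed (zar X) Z" "polyfun f" "polyfun g"
    "\<And>z. z \<in> Z \<Longrightarrow> f z * g z = 0" "x \<in> Z" "f x \<noteq> 0" "z \<in> Z"
  shows "g z = 0"
proof -
  have ZX: "Z \<subseteq> X" using assms(1) closedin_subset unfolding irreducible_closed_def by fastforce
  have "Z \<subseteq> {x\<in>X. f x = 0} \<union> {x\<in>X. g x = 0}" using assms(4) ZX by fastforce
  then have "Z \<subseteq> {x\<in>X. f x = 0} \<or> Z \<subseteq> {x\<in>X. g x = 0}"
    by (rule irreducible_closed_subset_Un[OF assms(1) closedin_zar_vanishing[OF assms(2)]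
          closedin_zar_vanishing[OF assms(3)]])
  then show ?thesis using assms(5-7) by auto
qed

text \<open>The common core of the suprema in \<open>local_dim\<close> and
  \<open>codim_irreducible\<close>, which differ only in what they ask of the first member.\<close>

definition closed_chain :: "'a topology \<Rightarrow> nat \<Rightarrow> (nat \<Rightarrow> 'a set) \<Rightarrow> bool" where
  "closed_chain T n C \<longleftrightarrow> (\<forall>i\<le>n. irreducible_closed T (C i)) \<and> (\<forall>i<n. C i \<subset> C (Suc i))"

lemma closed_chain_0: "irreducible_closed T Z \<Longrightarrow> closed_chain T 0 (\<lambda>_. Z)"
  by (simp add: closed_chain_def)

lemma closed_chain_Suc:
  assumes "closed_chain T n C" "irreducible_closed T Z" "C n \<subset> Z"
  shows "closed_chain T (Suc n) (C(Suc n := Z))"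
  using assms unfolding closed_chain_def by (auto simp: le_Suc_eq less_Suc_eq)

lemma closed_chain_mono: "closed_chain T n C \<Longrightarrow> i \<le> j \<Longrightarrow> j \<le> n \<Longrightarrow> C i \<subseteq> C j"
proof (induction j)
  case (Suc j)
  then show ?case unfolding closed_chain_def by (cases "i = Suc j") (auto dest!: spec[of _ j])
qed simp

lemma local_dim_altdef:
  "local_dim X x = Sup {enat n |n. \<exists>C. x \<in> C 0 \<and> closed_chain (zar X) n C}"
  unfolding local_dim_def closed_chain_def by simp

lemma codim_irreducible_altdef:
  "codim_irreducible T Z = Sup {enat n |n. \<exists>C. C 0 = Z \<and> closed_chain T n C}"
  unfolding codim_irreducible_def closed_chain_def by simp

section \<open>A bound for the length of chains of irreducible closed sets\<close>

text \<open>Gaussian elimination, one equation at a time: \<open>b0\<close> eliminates the unknown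
  \<open>i0\<close>. Finite index sets are used because the size of the system will grow with a
  degree bound.\<close>

lemma homogeneous_system_nontrivial_solution:
  fixes A :: "'i \<Rightarrow> 'b \<Rightarrow> 'k::field"
  assumes "finite B" "finite I" "card B < card I"
  shows "\<exists>c. (\<exists>i\<in>I. c i \<noteq> 0) \<and> (\<forall>b\<in>B. (\<Sum>i\<in>I. c i * A i b) = 0)"
  using assms
proof (induction B arbitrary: I A rule: finite_induct)
  case empty
  then have "I \<noteq> {}" by auto
  then show ?case by (intro exI[of _ "\<lambda>_. 1"]) auto
next
  case (insert b0 B)
  show ?case
  proof (cases "\<forall>i\<in>I. A i b0 = 0")
    case True
    then show ?thesis using insert.IH[of I A] insert.prems insert.hyps by auto
  next
    case False
    then obtain i0 where i0: "i0 \<in> I" "A i0 b0 \<noteq> 0" by blast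
    define I' where "I' = I - {i0}"
    define q where "q = (\<lambda>i. A i b0 / A i0 b0)"
    have I: "I = insert i0 I'" "i0 \<notin> I'" "finite I'"
      using i0 insert.prems by (auto simp: I'_def)
    have "card B < card I'" using insert.prems insert.hyps I by simp
    then obtain c where c: "\<exists>i\<in>I'. c i \<noteq> 0"
      "\<forall>b\<in>B. (\<Sum>i\<in>I'. c i * (A i b - q i * A i0 b)) = 0"
      using insert.IH[of I' "\<lambda>i b. A i b - q i * A i0 b"] I(3) by blast
    define c' where "c' = c(i0 := - (\<Sum>i\<in>I'. c i * q i))"
    have sum: "(\<Sum>i\<in>I. c' i * A i b) = (\<Sum>i\<in>I'. c i * (A i b - q i * A i0 b))" for b
    proof -
      have "(\<Sum>i\<in>I'. c' i * A i b) = (\<Sum>i\<in>I'. c i * A i b)"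
        using I by (intro sum.cong) (auto simp: c'_def)
      then have "(\<Sum>i\<in>I. c' i * A i b) = (\<Sum>i\<in>I'. c i * A i b) - (\<Sum>i\<in>I'. c i * q i) * A i0 b"
        unfolding I(1) using I by (simp add: c'_def)
      then show ?thesis
        by (simp add: algebra_simps sum_subtractf sum_distrib_left sum_distrib_right)
    qed
    have "(\<Sum>i\<in>I. c' i * A i b0) = 0"
      unfolding sum using i0 by (simp add: q_def)
    moreover have "\<exists>i\<in>I. c' i \<noteq> 0"
      using c(1) I by (auto simp: c'_def)
    ultimately show ?thesis
      using c(2) sum by (intro exI[of _ c']) auto
  qed
qed

text \<open>Each exponent is bounded separately, so the monomials form a box whose size is a plain
  power of \<open>d + 1\<close>.\<close>

definition bounded_exponents :: "nat \<Rightarrow> ('n::finite \<Rightarrow>\<^sub>0 nat) set" where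
  "bounded_exponents d = {m. \<forall>i. Poly_Mapping.lookup m i \<le> d}"

lemma finite_card_bounded_exponents:
  "finite (bounded_exponents d :: ('n::finite \<Rightarrow>\<^sub>0 nat) set) \<and>
    card (bounded_exponents d :: ('n \<Rightarrow>\<^sub>0 nat) set) \<le> (d + 1) ^ CARD('n)"
proof -
  have inj: "inj_on Poly_Mapping.lookup (bounded_exponents d :: ('n \<Rightarrow>\<^sub>0 nat) set)"
    by (simp add: inj_on_def poly_mapping_eqI)
  have sub: "Poly_Mapping.lookup ` (bounded_exponents d :: ('n \<Rightarrow>\<^sub>0 nat) set) \<subseteq> PiE UNIV (\<lambda>_. {..d})"
    by (auto simp: bounded_exponents_def)
  have fin: "finite (PiE (UNIV :: 'n set) (\<lambda>_. {..d}))" by (intro finite_PiE) auto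
  show ?thesis
    using inj_on_finite[OF inj sub fin] card_inj_on_le[OF inj sub fin] by (simp add: card_PiE)
qed

definition bounded_degree :: "nat \<Rightarrow> ('k::comm_ring_1 ^ 'n::finite \<Rightarrow> 'k) \<Rightarrow> bool" where
  "bounded_degree d h \<longleftrightarrow> (\<exists>f. h = mveval f \<and> Poly_Mapping.keys f \<subseteq> bounded_exponents d)"

lemma bounded_exponents_mono: "d \<le> e \<Longrightarrow> bounded_exponents d \<subseteq> bounded_exponents e"
  unfolding bounded_exponents_def by (auto intro: order_trans)

lemma bounded_degree_mono: "bounded_degree d h \<Longrightarrow> d \<le> e \<Longrightarrow> bounded_degree e h"
  unfolding bounded_degree_def using bounded_exponents_mono by blast

lemma polyfun_bounded_degree:
  assumes "polyfun h"
  shows "\<exists>d. bounded_degree d h"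
proof -
  obtain f where f: "h = mveval f" using assms polyfun_def by blast
  define d where "d = (\<Sum>m\<in>Poly_Mapping.keys f. \<Sum>i\<in>UNIV. Poly_Mapping.lookup m i)"
  have "Poly_Mapping.lookup m i \<le> d" if "m \<in> Poly_Mapping.keys f" for m i
  proof -
    have "Poly_Mapping.lookup m i \<le> (\<Sum>i\<in>UNIV. Poly_Mapping.lookup m i)"
      by (rule member_le_sum) auto
    also have "\<dots> \<le> d"
      unfolding d_def by (rule member_le_sum[OF that]) auto
    finally show ?thesis .
  qed
  then show ?thesis
    unfolding bounded_degree_def bounded_exponents_def using f by auto
qed

lemma bounded_degree_one: "bounded_degree d (\<lambda>x. 1)"
  unfolding bounded_degree_def
  by (intro exI[of _ 1]) (auto simp: mveval_one fun_eq_iff bounded_exponents_def)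

lemma bounded_degree_mult:
  assumes "bounded_degree d f" "bounded_degree e g"
  shows "bounded_degree (d + e) (\<lambda>x. f x * g x)"
proof -
  obtain p q where p: "f = mveval p" "Poly_Mapping.keys p \<subseteq> bounded_exponents d"
    and q: "g = mveval q" "Poly_Mapping.keys q \<subseteq> bounded_exponents e"
    using assms unfolding bounded_degree_def by blast
  have "Poly_Mapping.keys (p * q) \<subseteq> bounded_exponents (d + e)"
  proof
    fix m assume "m \<in> Poly_Mapping.keys (p * q)"
    then have "m \<in> {a + b |a b. a \<in> Poly_Mapping.keys p \<and> b \<in> Poly_Mapping.keys q}"
      using keys_mult[of p q] by (rule subsetD[rotated])
    then obtain a b where ab: "m = a + b" "a \<in> Poly_Mapping.keys p" "b \<in> Poly_Mapping.keys q"
      unfolding mem_Collect_eq by (elim exE conjE)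
    moreover have "a \<in> bounded_exponents d" "b \<in> bounded_exponents e"
      using subsetD[OF p(2) ab(2)] subsetD[OF q(2) ab(3)] by simp_all
    ultimately show "m \<in> bounded_exponents (d + e)"
      by (simp add: bounded_exponents_def lookup_add add_mono)
  qed
  then show ?thesis
    unfolding bounded_degree_def using p q by (intro exI[of _ "p * q"]) (auto simp: mveval_mult)
qed

lemma bounded_degree_power:
  "bounded_degree d f \<Longrightarrow> bounded_degree (n * d) (\<lambda>x. f x ^ n)"
  by (induction n) (auto intro: bounded_degree_one bounded_degree_mult)

lemma linear_relation_bounded_degree:
  fixes g :: "'i \<Rightarrow> 'k::field ^ 'n::finite \<Rightarrow> 'k"
  assumes "finite I" "\<And>i. i \<in> I \<Longrightarrow> bounded_degree d (g i)" "(d + 1) ^ CARD('n) < card I"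
  shows "\<exists>c. (\<exists>i\<in>I. c i \<noteq> 0) \<and> (\<forall>y. (\<Sum>i\<in>I. c i * g i y) = 0)"
proof -
  let ?B = "bounded_exponents d :: ('n \<Rightarrow>\<^sub>0 nat) set"
  have B: "finite ?B" "card ?B < card I"
    using finite_card_bounded_exponents[where 'n = 'n, of d] assms(3) by auto
  obtain F where F: "\<And>i. i \<in> I \<Longrightarrow> g i = mveval (F i)"
    "\<And>i. i \<in> I \<Longrightarrow> Poly_Mapping.keys (F i) \<subseteq> ?B"
    using assms(2) unfolding bounded_degree_def by metis
  obtain c where c: "\<exists>i\<in>I. c i \<noteq> 0"
    "\<forall>b\<in>?B. (\<Sum>i\<in>I. c i * Poly_Mapping.lookup (F i) b) = 0"
    using homogeneous_system_nontrivial_solution[OF B(1) assms(1) B(2),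
        of "\<lambda>i. Poly_Mapping.lookup (F i)"] by (elim exE conjE)
  have "(\<Sum>i\<in>I. c i * g i y) = 0" for y
  proof -
    let ?mon = "\<lambda>m. \<Prod>i\<in>UNIV. y $ i ^ Poly_Mapping.lookup m i"
    have "(\<Sum>i\<in>I. c i * g i y) = (\<Sum>i\<in>I. \<Sum>m\<in>?B. c i * Poly_Mapping.lookup (F i) m * ?mon m)"
      by (intro sum.cong refl)
        (simp add: F(1) mveval_superset[OF B(1) F(2)] sum_distrib_left mult_ac)
    also have "\<dots> = (\<Sum>m\<in>?B. (\<Sum>i\<in>I. c i * Poly_Mapping.lookup (F i) m) * ?mon m)"
      by (subst sum.swap) (simp add: sum_distrib_right)
    finally show ?thesis using c(2) by simp
  qed
  then show ?thesis using c(1) by blast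
qed

text \<open>The head of the list is the exponent of the function with the largest index, so removing
  it in an induction removes the function attached to the last step of the chain.\<close>

primrec list_monomial :: "(nat \<Rightarrow> 'x \<Rightarrow> 'k::comm_ring_1) \<Rightarrow> nat list \<Rightarrow> 'x \<Rightarrow> 'k" where
  "list_monomial f [] x = 1"
| "list_monomial f (k # ks) x = f (length ks) x ^ k * list_monomial f ks x"

abbreviation bounded_lists :: "nat \<Rightarrow> nat \<Rightarrow> nat list set" where
  "bounded_lists d m \<equiv> {ks. set ks \<subseteq> {..d} \<and> length ks = m}"

lemma sum_bounded_lists_Suc:
  "(\<Sum>ks\<in>bounded_lists d (Suc m). G ks) = (\<Sum>k\<le>d. \<Sum>ks\<in>bounded_lists d m. G (k # ks))"
proof -
  have "bounded_lists d (Suc m) = (\<lambda>(k, ks). k # ks) ` ({..d} \<times> bounded_lists d m)"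
    by (auto simp: length_Suc_conv image_iff)
  moreover have "inj_on (\<lambda>(k, ks). k # ks) ({..d} \<times> bounded_lists d m)"
    by (auto simp: inj_on_def)
  ultimately have "(\<Sum>ks\<in>bounded_lists d (Suc m). G ks) =
      (\<Sum>(k, ks)\<in>{..d} \<times> bounded_lists d m. G (k # ks))"
    by (simp add: sum.reindex case_prod_unfold)
  then show ?thesis by (simp add: sum.cartesian_product)
qed

lemma polyfun_list_monomial: "(\<And>j. j < length ks \<Longrightarrow> polyfun (f j)) \<Longrightarrow> polyfun (list_monomial f ks)"
proof (induction ks)
  case Nil
  have "list_monomial f [] = (\<lambda>x. 1)" by auto
  then show ?case by (simp add: polyfun_const)
next
  case (Cons k ks)
  have "list_monomial f (k # ks) = (\<lambda>x. f (length ks) x ^ k * list_monomial f ks x)" by auto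
  then show ?case using Cons by (simp add: polyfun_mult polyfun_power)
qed

lemma bounded_degree_list_monomial:
  "(\<And>j. j < length ks \<Longrightarrow> bounded_degree e (\<lambda>y. f j (g y))) \<Longrightarrow> set ks \<subseteq> {..d} \<Longrightarrow>
    bounded_degree (length ks * (e * d)) (\<lambda>y. list_monomial f ks (g y))"
proof (induction ks)
  case (Cons k ks)
  have "bounded_degree (k * e) (\<lambda>y. f (length ks) (g y) ^ k)"
    using Cons.prems by (intro bounded_degree_power) auto
  then have "bounded_degree (e * d) (\<lambda>y. f (length ks) (g y) ^ k)"
    by (rule bounded_degree_mono) (use Cons.prems in \<open>auto simp: mult.commute\<close>)
  moreover have "bounded_degree (length ks * (e * d)) (\<lambda>y. list_monomial f ks (g y))"
    using Cons by auto
  ultimately show ?case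
    using bounded_degree_mult[of "e * d" _ "length ks * (e * d)"] by simp
qed (auto intro: bounded_degree_one)

text \<open>
  Functions that vanish on one member of a chain but not on the next are algebraically independent
  on the largest member: dividing a relation by the last function and restricting to the previous
  member kills one coefficient after the other.
\<close>

lemma chain_algebraically_independent:
  assumes "\<And>j. j \<le> m \<Longrightarrow> irreducible_closed (zar X) (Z j)"
    and "\<And>j. j < m \<Longrightarrow> polyfun (f j)"
    and "\<And>j. j < m \<Longrightarrow> Z j \<subseteq> Z (Suc j)"
    and "\<And>j z. j < m \<Longrightarrow> z \<in> Z j \<Longrightarrow> f j z = 0"
    and "\<And>j. j < m \<Longrightarrow> \<exists>z\<in>Z (Suc j). f j z \<noteq> 0"
    and "\<And>z. z \<in> Z m \<Longrightarrow> (\<Sum>ks\<in>bounded_lists d m. c ks * list_monomial f ks z) = 0"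
    and "ks \<in> bounded_lists d m"
  shows "c ks = 0"
  using assms
proof (induction m arbitrary: c ks)
  case 0
  have L: "bounded_lists d 0 = {[]}" by auto
  obtain z where "z \<in> Z 0" using 0(1)[of 0] unfolding irreducible_closed_def by auto
  with 0(6) have "(\<Sum>ks\<in>{[]}. c ks * list_monomial f ks z) = 0" unfolding L by blast
  moreover have "ks = []" using 0(7) by simp
  ultimately show ?case by simp
next
  case (Suc m)
  define G where "G = (\<lambda>k z. \<Sum>ks\<in>bounded_lists d m. c (k # ks) * list_monomial f ks z)"
  have polyG: "polyfun (G k)" for k
    unfolding G_def using Suc.prems(2)
    by (intro polyfun_sum polyfun_mult polyfun_const polyfun_list_monomial) auto
  have rel: "(\<Sum>k\<le>d. f m z ^ k * G k z) = 0" if "z \<in> Z (Suc m)" for z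
  proof -
    have "f m z ^ k * G k z = (\<Sum>ks\<in>bounded_lists d m. c (k # ks) * list_monomial f (k # ks) z)" for k
      unfolding G_def sum_distrib_left by (intro sum.cong) (auto simp: mult_ac)
    then show ?thesis using Suc.prems(6)[OF that] by (simp add: sum_bounded_lists_Suc)
  qed
  have step: "c (j # ks) = 0"
    if j: "j \<le> d" and IH: "\<And>k ks. k < j \<Longrightarrow> ks \<in> bounded_lists d m \<Longrightarrow> c (k # ks) = 0"
      and ks: "ks \<in> bounded_lists d m" for j ks
  proof -
    \<comment> \<open>The coefficients of exponents below \<open>j\<close> vanish by the induction
      hypothesis, so the relation is divisible by the \<open>j\<close>-th power of
      \<open>f m\<close>; irreducibility of the last member permits the division.\<close>
    define H where "H = (\<lambda>z. \<Sum>k\<in>{j..d}. f m z ^ (k - j) * G k z)"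
    have polyH: "polyfun H"
      unfolding H_def using Suc.prems(2)
      by (intro polyfun_sum polyfun_mult polyfun_power polyG) auto
    have fH: "f m z ^ j * H z = 0" if "z \<in> Z (Suc m)" for z
    proof -
      have "f m z ^ j * H z = (\<Sum>k\<in>{j..d}. f m z ^ k * G k z)"
        unfolding H_def sum_distrib_left mult.assoc[symmetric]
        by (intro sum.cong) (auto simp flip: power_add)
      also have "\<dots> = (\<Sum>k\<le>d. f m z ^ k * G k z)"
      proof (rule sum.mono_neutral_left)
        show "\<forall>k\<in>{..d} - {j..d}. f m z ^ k * G k z = 0"
        proof
          fix k assume "k \<in> {..d} - {j..d}"
          then have "k < j" by auto
          then have "G k z = 0" unfolding G_def using IH by (intro sum.neutral) auto
          then show "f m z ^ k * G k z = 0" by simp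
        qed
      qed auto
      finally show ?thesis using rel[OF that] by simp
    qed
    obtain z0 where "z0 \<in> Z (Suc m)" "f m z0 \<noteq> 0" using Suc.prems(5)[of m] by auto
    then have H0: "H z = 0" if "z \<in> Z (Suc m)" for z
      using irreducible_closed_mult_eq_0[OF Suc.prems(1)[of "Suc m"], of "\<lambda>z. f m z ^ j" H z0 z]
        polyfun_power[OF Suc.prems(2)[of m], of j] polyH fH that by auto
    have "G j z = 0" if "z \<in> Z m" for z
    proof -
      \<comment> \<open>Where \<open>f m\<close> vanishes only the term \<open>k = j\<close>
        survives, with \<open>0 ^ 0 = 1\<close>.\<close>
      have "H z = (\<Sum>k\<in>{j..d}. if k = j then G j z else 0)"
        unfolding H_def using Suc.prems(4)[of m z] that by (intro sum.cong) auto
      then have "H z = G j z" using j by simp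
      moreover have "z \<in> Z (Suc m)" using Suc.prems(3)[of m] that by auto
      ultimately show ?thesis using H0 by simp
    qed
    then have "(\<Sum>ks\<in>bounded_lists d m. c (j # ks) * list_monomial f ks z) = 0" if "z \<in> Z m" for z
      using that unfolding G_def by blast
    then show ?thesis
      using Suc.IH[of "\<lambda>ks. c (j # ks)", OF _ _ _ _ _ _ ks] Suc.prems by simp
  qed
  have "c (j # ks) = 0" if "j \<le> d" "ks \<in> bounded_lists d m" for j ks
    using that
  proof (induction j arbitrary: ks rule: less_induct)
    case (less j)
    show ?case by (rule step) (use less in auto)
  qed
  moreover obtain j ks' where "ks = j # ks'" "j \<le> d" "ks' \<in> bounded_lists d m"
    using Suc.prems(7) by (auto simp: length_Suc_conv)
  ultimately show ?case by simp
qed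

text \<open>
  In \<open>k\<^sup>n\<close> the \<open>(d + 1)\<^sup>m\<close> monomials of exponents at most \<open>d\<close> in \<open>m\<close> algebraically independent functions
  live in a space of dimension \<open>O(d\<^sup>n)\<close>.
\<close>

theorem closed_chain_length_le:
  fixes X :: "('k::alg_closed_field ^ 'n::finite) set" and g :: "'k ^ 'p::finite \<Rightarrow> 'k ^ 'n"
  assumes poly: "\<And>i. polyfun (\<lambda>y. g y $ i)"
    and dense: "\<And>h x. polyfun h \<Longrightarrow> (\<And>y. h (g y) = 0) \<Longrightarrow> x \<in> X \<Longrightarrow> h x = 0"
    and chain: "closed_chain (zar X) m Z"
  shows "m \<le> CARD('p)"
proof (rule ccontr)
  assume less: "\<not> m \<le> CARD('p)"
  define n where "n = CARD('p)"
  have irr: "irreducible_closed (zar X) (Z j)" if "j \<le> m" for j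
    using chain that unfolding closed_chain_def by blast
  have ZX: "Z j \<subseteq> X" if "j \<le> m" for j
    using irr[OF that] closedin_subset unfolding irreducible_closed_def by fastforce
  have "\<exists>f. polyfun f \<and> (\<forall>z\<in>Z j. f z = 0) \<and> (\<exists>z\<in>Z (Suc j). f z \<noteq> 0)" if "j < m" for j
  proof -
    have "Z j \<subset> Z (Suc j)" using chain that unfolding closed_chain_def by simp
    then obtain z where "z \<in> Z (Suc j)" "z \<notin> Z j" by (meson psubset_imp_ex_mem DiffE)
    moreover have "closedin (zar X) (Z j)" using irr[of j] that unfolding irreducible_closed_def by simp
    moreover have "z \<in> X" using calculation(1) ZX[of "Suc j"] that by auto
    ultimately obtain h where "polyfun h" "\<And>z. z \<in> Z j \<Longrightarrow> h z = 0" "h z \<noteq> 0"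
      using closed_separating_polyfun by blast
    then show ?thesis using \<open>z \<in> Z (Suc j)\<close> by blast
  qed
  then obtain f where f: "\<And>j. j < m \<Longrightarrow> polyfun (f j)" "\<And>j z. j < m \<Longrightarrow> z \<in> Z j \<Longrightarrow> f j z = 0"
    "\<And>j. j < m \<Longrightarrow> \<exists>z\<in>Z (Suc j). f j z \<noteq> 0"
    by metis
  have "\<exists>e. \<forall>j<m. bounded_degree e (\<lambda>y. f j (g y))"
  proof -
    have "\<exists>d. bounded_degree d (\<lambda>y. f j (g y))" if "j < m" for j
      using polyfun_bounded_degree polyfun_comp[OF f(1)[OF that] poly] by blast
    then obtain D where D: "\<And>j. j < m \<Longrightarrow> bounded_degree (D j) (\<lambda>y. f j (g y))" by metis
    have "bounded_degree (\<Sum>j<m. D j) (\<lambda>y. f j (g y))" if "j < m" for j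
      by (rule bounded_degree_mono[OF D[OF that]]) (use that in \<open>auto intro: member_le_sum\<close>)
    then show ?thesis by blast
  qed
  then obtain e where e: "\<And>j. j < m \<Longrightarrow> bounded_degree e (\<lambda>y. f j (g y))" by blast
  \<comment> \<open>Pulled back along \<open>g\<close>, the monomials have exponents at most
    \<open>m * e * d\<close>, which is below \<open>a * (d + 1)\<close>. In the \<open>n\<close>-th
    power the constant contributes \<open>a ^ n = d\<close>, still less than the extra factor
    \<open>d + 1\<close> gained from \<open>m > n\<close>.\<close>
  define a where "a = m * e + 1"
  define d where "d = a ^ n"
  let ?L = "bounded_lists d m"
  have fin: "finite ?L" by (rule finite_lists_length_eq) simp
  have "(m * (e * d) + 1) ^ n \<le> (a * (d + 1)) ^ n"
    by (intro power_mono) (auto simp: a_def algebra_simps)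
  also have "\<dots> < (d + 1) * (d + 1) ^ n"
    unfolding power_mult_distrib d_def by simp
  also have "\<dots> = (d + 1) ^ (n + 1)" by simp
  also have "\<dots> \<le> (d + 1) ^ m"
    using less by (intro power_increasing) (auto simp: n_def)
  also have "\<dots> = card ?L" by (subst card_lists_length_eq) auto
  finally have "(m * (e * d) + 1) ^ CARD('p) < card ?L" by (simp add: n_def)
  moreover have "bounded_degree (m * (e * d)) (\<lambda>y. list_monomial f ks (g y))" if "ks \<in> ?L" for ks
    using bounded_degree_list_monomial[of ks e f g d] e that by auto
  ultimately obtain c where c: "\<exists>ks\<in>?L. c ks \<noteq> 0"
    "\<And>y. (\<Sum>ks\<in>?L. c ks * list_monomial f ks (g y)) = 0"
    using linear_relation_bounded_degree[OF fin, of "m * (e * d)" "\<lambda>ks y. list_monomial f ks (g y)"]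
    by blast
  have "polyfun (\<lambda>x. \<Sum>ks\<in>?L. c ks * list_monomial f ks x)"
    using f(1) by (intro polyfun_sum polyfun_mult polyfun_const polyfun_list_monomial) auto
  then have rel: "(\<Sum>ks\<in>?L. c ks * list_monomial f ks x) = 0" if "x \<in> X" for x
    using dense c(2) that by blast
  have "c ks = 0" if "ks \<in> ?L" for ks
  proof (rule chain_algebraically_independent[of m X Z f c d])
    show "Z j \<subseteq> Z (Suc j)" if "j < m" for j
      using closed_chain_mono[OF chain, of j "Suc j"] that by simp
    show "(\<Sum>ks\<in>?L. c ks * list_monomial f ks z) = 0" if "z \<in> Z m" for z
      using rel that ZX[of m] by auto
  qed (use irr f that in auto)
  then show False using c(1) by blast
qed

section \<open>Matrices of size three\<close>

definition mat33 :: "'k \<Rightarrow> 'k \<Rightarrow> 'k \<Rightarrow> 'k \<Rightarrow> 'k \<Rightarrow> 'k \<Rightarrow> 'k \<Rightarrow> 'k \<Rightarrow> 'k \<Rightarrow> 'k::zero ^ 3 ^ 3" where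
  "mat33 a b c d e f g h i = vector [vector [a, b, c], vector [d, e, f], vector [g, h, i]]"

lemma mat33_nth [simp]:
  "mat33 a b c d e f g h i $ 1 $ 1 = a" "mat33 a b c d e f g h i $ 1 $ 2 = b"
  "mat33 a b c d e f g h i $ 1 $ 3 = c" "mat33 a b c d e f g h i $ 2 $ 1 = d"
  "mat33 a b c d e f g h i $ 2 $ 2 = e" "mat33 a b c d e f g h i $ 2 $ 3 = f"
  "mat33 a b c d e f g h i $ 3 $ 1 = g" "mat33 a b c d e f g h i $ 3 $ 2 = h"
  "mat33 a b c d e f g h i $ 3 $ 3 = i"
  by (simp_all add: mat33_def)

lemma mat33_eq_iff:
  "A = B \<longleftrightarrow> A $ 1 $ 1 = B $ 1 $ 1 \<and> A $ 1 $ 2 = B $ 1 $ 2 \<and> A $ 1 $ 3 = B $ 1 $ 3 \<and>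
    A $ 2 $ 1 = B $ 2 $ 1 \<and> A $ 2 $ 2 = B $ 2 $ 2 \<and> A $ 2 $ 3 = B $ 2 $ 3 \<and>
    A $ 3 $ 1 = B $ 3 $ 1 \<and> A $ 3 $ 2 = B $ 3 $ 2 \<and> A $ 3 $ 3 = B $ (3::3) $ (3::3)"
  by (auto simp: vec_eq_iff forall_3)

lemma matrix_mult_33_nth:
  fixes A B :: "'k::semiring_1 ^ 3 ^ 3"
  shows "(A ** B) $ i $ j = A $ i $ 1 * B $ 1 $ j + A $ i $ 2 * B $ 2 $ j + A $ i $ 3 * B $ 3 $ j"
  by (simp add: matrix_matrix_mult_def sum_3)

lemma mat_33_nth:
  "(mat c :: 'k::zero ^ 3 ^ 3) $ 1 $ 1 = c" "(mat c :: 'k ^ 3 ^ 3) $ 2 $ 2 = c"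
  "(mat c :: 'k ^ 3 ^ 3) $ 3 $ 3 = c" "(mat c :: 'k ^ 3 ^ 3) $ 1 $ 2 = 0"
  "(mat c :: 'k ^ 3 ^ 3) $ 1 $ 3 = 0" "(mat c :: 'k ^ 3 ^ 3) $ 2 $ 1 = 0"
  "(mat c :: 'k ^ 3 ^ 3) $ 2 $ 3 = 0" "(mat c :: 'k ^ 3 ^ 3) $ 3 $ 1 = 0"
  "(mat c :: 'k ^ 3 ^ 3) $ 3 $ 2 = 0"
  by (simp_all add: mat_def)

lemma trace_33: "trace A = A $ 1 $ 1 + A $ 2 $ 2 + A $ (3::3) $ (3::3)"
  by (simp add: trace_def sum_3)

lemmas m33_simps = mat33_eq_iff matrix_mult_33_nth mat_33_nth trace_33

lemma mat_mult_nth: "(mat c ** A) $ i $ j = c * (A :: 'k::semiring_1 ^ 'm ^ 'n::finite) $ i $ j"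
proof -
  have "(mat c ** A) $ i $ j = (\<Sum>l\<in>UNIV. if l = i then c * A $ l $ j else 0)"
    unfolding matrix_matrix_mult_def mat_def vec_lambda_beta by (intro sum.cong) auto
  then show ?thesis by simp
qed

lemma mat_commutes:
  fixes A :: "'k::comm_semiring_1 ^ 3 ^ 3"
  shows "mat c ** A = A ** mat c"
  by (simp add: m33_simps mult.commute)

section \<open>The adjugate and nilpotent matrices\<close>

definition adj3 :: "'k::comm_ring_1 ^ 3 ^ 3 \<Rightarrow> 'k ^ 3 ^ 3" where
  "adj3 A = mat33
    (A $ 2 $ 2 * A $ 3 $ 3 - A $ 2 $ 3 * A $ 3 $ 2) (A $ 1 $ 3 * A $ 3 $ 2 - A $ 1 $ 2 * A $ 3 $ 3)
    (A $ 1 $ 2 * A $ 2 $ 3 - A $ 1 $ 3 * A $ 2 $ 2)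
    (A $ 2 $ 3 * A $ 3 $ 1 - A $ 2 $ 1 * A $ 3 $ 3) (A $ 1 $ 1 * A $ 3 $ 3 - A $ 1 $ 3 * A $ 3 $ 1)
    (A $ 1 $ 3 * A $ 2 $ 1 - A $ 1 $ 1 * A $ 2 $ 3)
    (A $ 2 $ 1 * A $ 3 $ 2 - A $ 2 $ 2 * A $ 3 $ 1) (A $ 1 $ 2 * A $ 3 $ 1 - A $ 1 $ 1 * A $ 3 $ 2)
    (A $ 1 $ 1 * A $ 2 $ 2 - A $ 1 $ 2 * A $ 2 $ 1)"

lemma mult_adj3: "A ** adj3 A = mat (det A)" and adj3_mult: "adj3 A ** A = mat (det A)"
  by (simp_all add: m33_simps adj3_def det_3 algebra_simps)

lemma det_33_0: "det (0 :: 'k::comm_ring_1 ^ 3 ^ 3) = 0"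
  by (simp add: det_3)

lemma adj3_matrix_mult: "adj3 (A ** B) = adj3 B ** adj3 A"
  by (simp add: m33_simps adj3_def algebra_simps)

definition sigma2 :: "'k::comm_ring_1 ^ 3 ^ 3 \<Rightarrow> 'k" where
  "sigma2 A = A $ 1 $ 1 * A $ 2 $ 2 + A $ 1 $ 1 * A $ 3 $ 3 + A $ 2 $ 2 * A $ 3 $ 3
    - A $ 1 $ 2 * A $ 2 $ 1 - A $ 1 $ 3 * A $ 3 $ 1 - A $ 2 $ 3 * A $ 3 $ 2"

text \<open>Cayley--Hamilton before multiplication by \<open>A\<close>; \<open>sigma2\<close> is the
  sum of the principal minors of size two.\<close>

lemma adj3_eq: "adj3 A + mat (trace A) ** A = A ** A + mat (sigma2 A)"
  by (simp add: m33_simps adj3_def sigma2_def algebra_simps)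

text \<open>With determinant and trace zero, Cayley--Hamilton reads
  \<open>A ** A ** A = mat (- sigma2 A) ** A\<close>. Odd powers are therefore scalar multiples of
  \<open>A\<close>, and nilpotency forces \<open>sigma2 A = 0\<close> or
  \<open>A = 0\<close>.\<close>

lemma nilpotent_cube_eq_0:
  fixes A :: "'k::field ^ 3 ^ 3"
  assumes "nilpotent_matrix A" "trace A = 0"
  shows "A ** A ** A = 0"
proof -
  let ?P = "\<lambda>m. (((**) A) ^^ m) (mat 1)"
  obtain m where m: "?P m = 0" using assms(1) unfolding nilpotent_matrix_def by auto
  have "det (?P n) = det A ^ n" for n
    by (induction n) (simp_all add: det_mul)
  from this[of m] have "det A ^ m = 0" unfolding m det_33_0 by simp
  then have det: "det A = 0" by simp
  have adj: "adj3 A = A ** A + mat (sigma2 A)"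
    using adj3_eq[of A] assms(2) by (simp add: mat_def vec_eq_iff matrix_matrix_mult_def)
  have "(A ** A + mat (sigma2 A)) ** A = 0"
    using adj3_mult[of A] unfolding adj det by simp
  then have cube: "A ** A ** A = mat (- sigma2 A) ** A"
    by (simp add: m33_simps algebra_simps eq_neg_iff_add_eq_0)
  have "?P (Suc (2 * n)) = mat ((- sigma2 A) ^ n) ** A" for n
  proof (induction n)
    case (Suc n)
    have "?P (Suc (2 * Suc n)) = A ** (A ** ?P (Suc (2 * n)))" by simp
    also have "\<dots> = A ** (A ** (mat ((- sigma2 A) ^ n) ** A))" unfolding Suc.IH ..
    also have "\<dots> = mat ((- sigma2 A) ^ n) ** (A ** A ** A)"
      by (simp add: m33_simps algebra_simps)
    also have "\<dots> = mat ((- sigma2 A) ^ Suc n) ** A"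
      unfolding cube by (simp add: m33_simps mult_ac)
    finally show ?case .
  qed simp
  moreover have "?P (m + n) = 0" for n
    using m by (induction n) (simp_all add: add.commute[of m])
  from this[of "Suc m"] have "?P (Suc (2 * m)) = 0"
    by (simp add: mult_2)
  ultimately have "mat ((- sigma2 A) ^ m) ** A = 0" by metis
  then have "(- sigma2 A) ^ m * A $ i $ j = 0" for i j
    by (metis mat_mult_nth zero_index)
  then have "sigma2 A = 0 \<or> A = 0" by (auto simp: vec_eq_iff)
  then show ?thesis unfolding cube by (auto simp: m33_simps)
qed

lemma nilpotent_matrix_of_cube: "A ** A ** A = 0 \<Longrightarrow> nilpotent_matrix A"
  unfolding nilpotent_matrix_def
  by (rule exI[of _ 3]) (simp add: eval_nat_numeral matrix_mul_assoc)

definition strict_upper :: "'k::zero \<Rightarrow> 'k \<Rightarrow> 'k \<Rightarrow> 'k ^ 3 ^ 3" where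
  "strict_upper x y z = mat33 0 x z 0 0 y 0 0 0"

lemma strict_upper_mult:
  "strict_upper x y z ** strict_upper x' y' z' = strict_upper 0 0 (x * y' :: 'k::semiring_1)"
  by (simp add: strict_upper_def m33_simps)

text \<open>The columns of \<open>G\<close> are the Jordan chain of a vector \<open>q\<close> that
  the square of \<open>A\<close> does not kill. The kernel of \<open>G\<close> is stable under the
  Jordan block, and shifting a kernel vector until only its first coordinate can survive shows that
  it is zero.\<close>

lemma regular_nilpotent_conjugate:
  fixes A :: "'k::field ^ 3 ^ 3"
  assumes "A ** A ** A = 0" "A ** A \<noteq> 0"
  obtains G G' where "G ** G' = mat 1" "G' ** G = mat 1" "A = G ** strict_upper 1 1 0 ** G'"
proof -
  obtain i0 j0 where "(A ** A) $ i0 $ j0 \<noteq> 0" using assms(2) by (auto simp: vec_eq_iff)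
  define q where "q = (axis j0 1 :: 'k ^ 3)"
  define u where "u = (A ** A) *v q"
  have "u $ i0 \<noteq> 0"
    using \<open>(A ** A) $ i0 $ j0 \<noteq> 0\<close>
    by (simp add: u_def q_def matrix_vector_mult_def axis_def if_distrib[of "\<lambda>x. _ * x"] cong: if_cong)
  then have u: "u \<noteq> 0" by auto
  let ?p = "A *v q"
  define G where "G = mat33 (u $ 1) (?p $ 1) (q $ 1) (u $ 2) (?p $ 2) (q $ 2) (u $ 3) (?p $ 3) (q $ 3)"
  let ?J = "strict_upper 1 1 0 :: 'k ^ 3 ^ 3"
  have "A *v u = 0" using assms(1) unfolding u_def
    by (metis matrix_vector_mul_assoc matrix_mul_assoc matrix_vector_mult_0)
  moreover have "A *v ?p = u" unfolding u_def by (simp add: matrix_vector_mul_assoc)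
  ultimately have AG: "A ** G = G ** ?J"
    by (auto simp: G_def strict_upper_def m33_simps vec_eq_iff forall_3 matrix_vector_mult_def sum_3)
  have "y = 0" if "G *v y = 0" for y
  proof -
    have AGy: "G *v (?J *v x) = 0" if "G *v x = 0" for x
    proof -
      have "G *v (?J *v x) = A *v (G *v x)" by (simp add: matrix_vector_mul_assoc AG)
      then show ?thesis using that by simp
    qed
    have 1: "x $ 3 = 0 \<Longrightarrow> x $ 2 = 0 \<Longrightarrow> x $ 1 = 0" if "G *v x = 0" for x
      using that u by (auto simp: G_def vec_eq_iff forall_3 matrix_vector_mult_def sum_3)
    have J: "(?J *v x) $ 1 = x $ 2" "(?J *v x) $ 2 = x $ 3" "(?J *v x) $ 3 = 0" for x
      by (simp_all add: strict_upper_def matrix_vector_mult_def sum_3)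
    have "y $ 3 = 0" using 1[OF AGy[OF AGy[OF that]]] J by simp
    moreover have "y $ 2 = 0" using 1[OF AGy[OF that]] J calculation by simp
    ultimately show ?thesis using 1[OF that] by (simp add: vec_eq_iff forall_3)
  qed
  then have "\<exists>G'. G' ** G = mat 1" by (simp add: matrix_left_invertible_ker)
  then obtain G' where G': "G' ** G = mat 1" by (elim exE)
  moreover have "G ** G' = mat 1" using G' by (simp add: matrix_left_right_inverse)
  moreover have "A = G ** ?J ** G'"
    using AG calculation(2) by (metis matrix_mul_assoc matrix_mul_rid)
  ultimately show thesis using that by blast
qed

text \<open>The centralizer of the Jordan block consists of the polynomials in it, and nilpotency
  removes the constant term.\<close>

lemma commuting_with_regular:
  fixes Y :: "'k::field ^ 3 ^ 3"
  assumes "Y ** strict_upper 1 1 0 = strict_upper 1 1 0 ** Y" "Y ** Y ** Y = 0"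
  shows "Y = strict_upper (Y $ 1 $ 2) (Y $ 1 $ 2) (Y $ 1 $ 3)"
proof -
  have *: "Y $ 2 $ 1 = 0" "Y $ 3 $ 1 = 0" "Y $ 3 $ 2 = 0" "Y $ 2 $ 2 = Y $ 1 $ 1"
    "Y $ 3 $ 3 = Y $ 1 $ 1" "Y $ 2 $ 3 = Y $ 1 $ 2"
    using assms(1) by (auto simp: m33_simps strict_upper_def)
  have "(Y ** Y ** Y) $ 1 $ 1 = 0" using assms(2) by simp
  then have "Y $ 1 $ 1 = 0" by (simp add: * matrix_mult_33_nth)
  then show ?thesis using * by (simp add: m33_simps strict_upper_def)
qed

section \<open>Rank one matrices and orthogonality in dimension three\<close>

definition dot :: "'k::comm_semiring_1 ^ 3 \<Rightarrow> 'k ^ 3 \<Rightarrow> 'k" where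
  "dot u w = u $ 1 * w $ 1 + u $ 2 * w $ 2 + u $ 3 * w $ 3"

definition outer :: "'k::semiring_1 ^ 3 \<Rightarrow> 'k ^ 3 \<Rightarrow> 'k ^ 3 ^ 3" where
  "outer u w = (\<chi> i j. u $ i * w $ j)"

lemma outer_nth [simp]: "outer u w $ i $ j = u $ i * w $ j"
  by (simp add: outer_def)

lemma outer_mult_nth: "(outer u w ** outer u' w') $ i $ j = dot w u' * (u $ i * w' $ j)"
  for u :: "'k::comm_semiring_1 ^ 3"
  by (simp add: matrix_mult_33_nth dot_def algebra_simps)

lemma trace_outer: "trace (outer u w) = dot u w"
  by (simp add: trace_33 dot_def)

definition cross :: "'k::comm_ring_1 ^ 3 \<Rightarrow> 'k ^ 3 \<Rightarrow> 'k ^ 3" where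
  "cross u w = vector [u $ 2 * w $ 3 - u $ 3 * w $ 2, u $ 3 * w $ 1 - u $ 1 * w $ 3,
     u $ 1 * w $ 2 - u $ 2 * w $ 1]"

lemma cross_nth [simp]:
  "cross u w $ 1 = u $ 2 * w $ 3 - u $ 3 * w $ 2" "cross u w $ 2 = u $ 3 * w $ 1 - u $ 1 * w $ 3"
  "cross u w $ 3 = u $ 1 * w $ 2 - u $ 2 * w $ 1"
  by (simp_all add: cross_def)

lemma cross_eq_0_imp_parallel:
  fixes u w :: "'k::field ^ 3"
  assumes "cross u w = 0" "u \<noteq> 0"
  obtains c where "w = c *s u"
proof -
  have c: "u $ 2 * w $ 3 = u $ 3 * w $ 2" "u $ 3 * w $ 1 = u $ 1 * w $ 3" "u $ 1 * w $ 2 = u $ 2 * w $ 1"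
    using assms(1) by (simp_all add: vec_eq_iff forall_3)
  have "u $ 1 \<noteq> 0 \<or> u $ 2 \<noteq> 0 \<or> u $ 3 \<noteq> 0" using assms(2) by (auto simp: vec_eq_iff forall_3)
  then show thesis
  proof (elim disjE)
    assume "u $ 1 \<noteq> 0"
    then show thesis using c by (intro that[of "w $ 1 / u $ 1"]) (auto simp: vec_eq_iff forall_3 field_simps)
  next
    assume "u $ 2 \<noteq> 0"
    then show thesis using c by (intro that[of "w $ 2 / u $ 2"]) (auto simp: vec_eq_iff forall_3 field_simps)
  next
    assume "u $ 3 \<noteq> 0"
    then show thesis using c by (intro that[of "w $ 3 / u $ 3"]) (auto simp: vec_eq_iff forall_3 field_simps)
  qed
qed

lemma orthogonal_to_both_imp_parallel_cross:
  fixes u v w :: "'k::field ^ 3"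
  assumes "dot w u = 0" "dot w v = 0" "cross u v \<noteq> 0"
  obtains c where "w = c *s cross u v"
proof -
  have "cross (cross u v) w = (dot w u) *s v - (dot w v) *s u"
    by (simp add: vec_eq_iff forall_3 dot_def algebra_simps)
  then show thesis using cross_eq_0_imp_parallel[of "cross u v" w] assms that by auto
qed

text \<open>Trades the equation \<open>dot u w = 0\<close> for a free parameter \<open>z\<close>;
  this makes the tuples with a common image line a family without side conditions.\<close>

lemma orthogonal_imp_cross:
  fixes u w :: "'k::field ^ 3"
  assumes "dot u w = 0" "u \<noteq> 0"
  obtains z where "w = cross u z"
proof -
  have "u $ 1 \<noteq> 0 \<or> u $ 2 \<noteq> 0 \<or> u $ 3 \<noteq> 0" using assms(2) by (auto simp: vec_eq_iff forall_3)
  then show thesis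
  proof (elim disjE)
    assume "u $ 1 \<noteq> 0"
    then show thesis using assms(1)
      by (intro that[of "vector [0, w $ 3 / u $ 1, - w $ 2 / u $ 1]"])
        (auto simp: vec_eq_iff forall_3 field_simps dot_def eq_neg_iff_add_eq_0)
  next
    assume "u $ 2 \<noteq> 0"
    then show thesis using assms(1)
      by (intro that[of "vector [- w $ 3 / u $ 2, 0, w $ 1 / u $ 2]"])
        (auto simp: vec_eq_iff forall_3 field_simps dot_def eq_neg_iff_add_eq_0)
  next
    assume "u $ 3 \<noteq> 0"
    then show thesis using assms(1)
      by (intro that[of "vector [w $ 2 / u $ 3, - w $ 1 / u $ 3, 0]"])
        (auto simp: vec_eq_iff forall_3 field_simps dot_def eq_neg_iff_add_eq_0)
  qed
qed

text \<open>By Cayley--Hamilton the adjugate of such a matrix vanishes, so its rank is at most one.\<close>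

lemma square_zero_outer:
  fixes A :: "'k::field ^ 3 ^ 3"
  assumes "A ** A = 0" "trace A = 0" "A \<noteq> 0"
  obtains u w where "A = outer u w" "dot u w = 0"
proof -
  have "det A * det A = 0" using det_mul[of A A] unfolding assms(1) det_33_0 by simp
  then have det: "det A = 0" by simp
  have adj: "adj3 A = mat (sigma2 A)"
    using adj3_eq[of A] assms(1,2) by (simp add: mat_def vec_eq_iff matrix_matrix_mult_def)
  have "mat (sigma2 A) ** A = 0" using adj3_mult[of A] unfolding adj det by simp
  then have "sigma2 A * A $ i $ j = 0" for i j by (metis mat_mult_nth zero_index)
  then have "sigma2 A = 0" using assms(3) by (auto simp: vec_eq_iff)
  then have adj0: "adj3 A = 0" using adj by simp
  obtain i j where ij: "A $ i $ j \<noteq> 0" using assms(3) by (auto simp: vec_eq_iff)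
  have "\<forall>i j k l. A $ i $ j * A $ k $ l = A $ i $ l * A $ k $ j"
    using adj0 unfolding forall_3 by (auto simp: m33_simps adj3_def algebra_simps)
  then have "A = outer (\<chi> k. A $ k $ j) (\<chi> l. A $ i $ l / A $ i $ j)"
    using ij by (auto simp: vec_eq_iff field_simps)
  then show thesis using that trace_outer assms(2) by metis
qed

lemma invertible_with_first_column:
  fixes u :: "'k::field ^ 3"
  assumes "u \<noteq> 0"
  obtains G G' :: "'k ^ 3 ^ 3"
  where "G ** G' = mat 1" "G' ** G = mat 1" "\<forall>i. G $ i $ 1 = u $ i"
proof -
  have "\<exists>G :: 'k ^ 3 ^ 3. det G \<noteq> 0 \<and> (\<forall>i. G $ i $ 1 = u $ i)"
  proof -
    have "u $ 1 \<noteq> 0 \<or> u $ 2 \<noteq> 0 \<or> u $ 3 \<noteq> 0" using assms by (auto simp: vec_eq_iff forall_3)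
    then show ?thesis
    proof (elim disjE)
      assume "u $ 1 \<noteq> 0"
      then show ?thesis
        by (intro exI[of _ "mat33 (u $ 1) 0 0 (u $ 2) 1 0 (u $ 3) 0 1"]) (simp add: det_3 forall_3)
    next
      assume "u $ 2 \<noteq> 0"
      then show ?thesis
        by (intro exI[of _ "mat33 (u $ 1) 1 0 (u $ 2) 0 0 (u $ 3) 0 1"]) (simp add: det_3 forall_3)
    next
      assume "u $ 3 \<noteq> 0"
      then show ?thesis
        by (intro exI[of _ "mat33 (u $ 1) 1 0 (u $ 2) 0 1 (u $ 3) 0 0"]) (simp add: det_3 forall_3)
    qed
  qed
  then obtain G :: "'k ^ 3 ^ 3" where G: "det G \<noteq> 0" "\<forall>i. G $ i $ 1 = u $ i" by blast
  then obtain G' where "G ** G' = mat 1" "G' ** G = mat 1"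
    using invertible_det_nz unfolding invertible_def by blast
  then show thesis by (rule that) (rule G(2))
qed

section \<open>The parametrization of the commuting variety\<close>

text \<open>\<open>mats\<close> and \<open>tup\<close> are inverse translations between points of
  the flat affine space and families of matrices.\<close>

definition mats :: "'k ^ ('r::finite \<times> 3 \<times> 3) \<Rightarrow> 'r \<Rightarrow> 'k ^ 3 ^ 3" where
  "mats v i = to_matrix (component v i)"

definition tup :: "('r \<Rightarrow> 'k ^ 3 ^ 3) \<Rightarrow> 'k ^ ('r::finite \<times> 3 \<times> 3)" where
  "tup X = (\<chi> p. X (fst p) $ fst (snd p) $ snd (snd p))"

lemma mats_nth: "mats v i $ a $ b = v $ (i, a, b)"
  by (simp add: mats_def to_matrix_def component_def)

lemma mats_tup [simp]: "mats (tup X) i = X i"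
  by (simp add: vec_eq_iff mats_nth tup_def)

lemma tup_mats [simp]: "tup (mats v) = v"
  by (simp add: vec_eq_iff mats_nth tup_def)

lemma mats_eqI: "(\<And>i. mats v i = mats w i) \<Longrightarrow> v = w"
  by (metis tup_mats ext)

lemma tup_nth: "tup X $ (i, a, b) = X i $ a $ b"
  by (simp add: tup_def)

abbreviation commuting_nilpotent :: "('k::field ^ ('r::finite \<times> 3 \<times> 3)) set" where
  "commuting_nilpotent \<equiv> commuting_variety nilpotent_cone"

lemma commuting_nilpotentD:
  assumes "v \<in> commuting_nilpotent"
  shows "mats v i ** mats v j = mats v j ** mats v i" "trace (mats v i) = 0"
    "mats v i ** mats v i ** mats v i = 0"
proof -
  show "mats v i ** mats v j = mats v j ** mats v i" "trace (mats v i) = 0"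
    using assms by (auto simp: commuting_variety_def mats_def nilpotent_cone_def sl3_def)
  then show "mats v i ** mats v i ** mats v i = 0"
    using nilpotent_cube_eq_0 assms
    by (auto simp: commuting_variety_def mats_def nilpotent_cone_def sl3_def)
qed

lemma commuting_nilpotentI:
  assumes "\<And>i j. mats v i ** mats v j = mats v j ** mats v i" "\<And>i. trace (mats v i) = 0"
    "\<And>i. mats v i ** mats v i ** mats v i = 0"
  shows "v \<in> commuting_nilpotent"
  using assms
  by (auto simp: commuting_variety_def mats_def nilpotent_cone_def sl3_def
      intro: nilpotent_matrix_of_cube)

text \<open>
  The columns of an invertible \<open>H\<close> span the flag; \<open>t = 0\<close> gives tuples with a common image line and
  \<open>s = 0\<close> tuples with a common kernel plane. The adjugate in place of the inverse keeps the map polynomial.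
\<close>

definition flagged :: "'k::comm_ring_1 ^ 3 ^ 3 \<Rightarrow> 'k \<Rightarrow> 'k \<Rightarrow> ('r \<Rightarrow> 'k) \<Rightarrow> ('r \<Rightarrow> 'k) \<Rightarrow>
    'k ^ ('r::finite \<times> 3 \<times> 3)" where
  "flagged H s t a b = tup (\<lambda>i. H ** strict_upper (a i * s) (a i * t) (b i) ** adj3 H)"

lemma conj_adj3_mult:
  "(H ** S ** adj3 H) ** (H ** S' ** adj3 H) = mat (det H) ** (H ** (S ** S') ** adj3 H)"
proof -
  have "(H ** S ** adj3 H) ** (H ** S' ** adj3 H) = H ** S ** (adj3 H ** H) ** S' ** adj3 H"
    by (simp add: matrix_mul_assoc)
  also have "\<dots> = (H ** S) ** mat (det H) ** S' ** adj3 H" by (simp add: adj3_mult)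
  also have "\<dots> = mat (det H) ** (H ** S) ** S' ** adj3 H" by (simp only: mat_commutes)
  finally show ?thesis by (simp add: matrix_mul_assoc)
qed

lemma flagged_mult:
  "mats (flagged H s t a b) i ** mats (flagged H s t a b) j =
    mat (det H) ** (H ** strict_upper 0 0 (a i * a j * s * t) ** adj3 H)"
  by (simp add: flagged_def conj_adj3_mult strict_upper_mult mult_ac)

lemma flagged_triple:
  "mats (flagged H s t a b) i ** mats (flagged H s t a b) j ** mats (flagged H s t a b) k = 0"
proof -
  let ?U = "strict_upper 0 0 (a i * a j * s * t)" and ?V = "strict_upper (a k * s) (a k * t) (b k)"
  have "(H ** ?U ** adj3 H) ** (H ** ?V ** adj3 H) = 0"
    unfolding conj_adj3_mult strict_upper_mult by (simp add: strict_upper_def m33_simps)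
  moreover have "mats (flagged H s t a b) k = H ** ?V ** adj3 H" by (simp add: flagged_def)
  ultimately show ?thesis
    unfolding flagged_mult by (metis matrix_mul_assoc times0_right)
qed

text \<open>All products reduce to \<open>adj3 H ** H = mat (det H)\<close>. For fixed
  \<open>H\<close>, \<open>s\<close>, \<open>t\<close>, a product of two members depends only on
  \<open>a i * a j\<close>, which is symmetric; for singular \<open>H\<close> it is zero.\<close>

lemma flagged_in_commuting_nilpotent: "flagged H s t a b \<in> commuting_nilpotent"
proof (rule commuting_nilpotentI)
  show "mats (flagged H s t a b) i ** mats (flagged H s t a b) j =
      mats (flagged H s t a b) j ** mats (flagged H s t a b) i" for i j
    by (simp add: flagged_mult mult_ac)
  show "trace (mats (flagged H s t a b) i) = 0" for i
  proof -
    let ?S = "strict_upper (a i * s) (a i * t) (b i)"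
    have "trace (H ** (?S ** adj3 H)) = trace (?S ** adj3 H ** H)" by (rule trace_mul_sym)
    also have "?S ** adj3 H ** H = ?S ** mat (det H)"
      by (simp add: adj3_mult flip: matrix_mul_assoc)
    also have "trace \<dots> = 0" by (simp add: m33_simps strict_upper_def)
    finally show ?thesis by (simp add: flagged_def matrix_mul_assoc)
  qed
qed (rule flagged_triple)

lemma conj_strict_upper_eq_adj3:
  fixes G :: "'k::field ^ 3 ^ 3"
  assumes "G ** G' = mat 1" "G' ** G = mat 1"
  shows "det G \<noteq> 0"
    "G ** strict_upper x y z ** G' = G ** strict_upper (x / det G) (y / det G) (z / det G) ** adj3 G"
proof -
  show det: "det G \<noteq> 0" using assms invertible_det_nz invertible_def by blast
  have "adj3 G = G' ** (G ** adj3 G)" using assms(2) by (simp add: matrix_mul_assoc)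
  then have adj: "adj3 G = mat (det G) ** G'" by (simp add: mult_adj3 mat_commutes)
  have "strict_upper (x / det G) (y / det G) (z / det G) ** mat (det G) = strict_upper x y z"
    using det by (simp add: m33_simps strict_upper_def)
  then show "G ** strict_upper x y z ** G' = G ** strict_upper (x / det G) (y / det G) (z / det G) ** adj3 G"
    unfolding adj by (metis matrix_mul_assoc)
qed

lemma conjugate_of_mult:
  fixes G :: "'k::field ^ 3 ^ 3"
  assumes "G ** G' = mat 1"
  shows "G ** (G' ** A ** G) ** G' = A"
  by (metis assms matrix_mul_assoc matrix_mul_lid matrix_mul_rid)

lemma flagged_of_conjugate:
  fixes v :: "'k::field ^ ('r::finite \<times> 3 \<times> 3)"
  assumes "G ** G' = mat 1" "G' ** G = mat 1"
    and "\<And>i. G' ** mats v i ** G = strict_upper (a i * s) (a i * t) (b i)"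
  shows "v = flagged G s t (\<lambda>i. a i / det G) (\<lambda>i. b i / det G)"
proof (rule mats_eqI)
  fix i
  have "mats v i = G ** strict_upper (a i * s) (a i * t) (b i) ** G'"
    using assms(3)[of i] conjugate_of_mult[OF assms(1), of "mats v i"] by simp
  then show "mats v i = mats (flagged G s t (\<lambda>i. a i / det G) (\<lambda>i. b i / det G)) i"
    using conj_strict_upper_eq_adj3(2)[OF assms(1,2)] by (simp add: flagged_def)
qed

lemma regular_tuple_conjugate:
  fixes v :: "'k::field ^ ('r::finite \<times> 3 \<times> 3)"
  assumes "v \<in> commuting_nilpotent" "mats v i0 ** mats v i0 \<noteq> 0"
  obtains G G' a b where "G ** G' = mat 1" "G' ** G = mat 1"
    "\<And>i. G' ** mats v i ** G = strict_upper (a i) (a i) (b i)" "a i0 = 1"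
proof -
  note D = commuting_nilpotentD[OF assms(1)]
  obtain G G' where G: "G ** G' = mat 1" "G' ** G = mat 1"
    "mats v i0 = G ** strict_upper 1 1 0 ** G'"
    using regular_nilpotent_conjugate[OF D(3) assms(2)] by blast
  define Y where "Y = (\<lambda>i. G' ** mats v i ** G)"
  have conj: "(G' ** A ** G) ** (G' ** B ** G) = G' ** (A ** B) ** G" for A B
  proof -
    have "(G' ** A ** G) ** (G' ** B ** G) = G' ** A ** (G ** G') ** B ** G"
      by (simp add: matrix_mul_assoc)
    then show ?thesis by (simp add: G(1) matrix_mul_assoc)
  qed
  have i0: "Y i0 = strict_upper 1 1 0"
    unfolding Y_def G(3) using conjugate_of_mult[OF G(2)] by simp
  have "Y i = strict_upper (Y i $ 1 $ 2) (Y i $ 1 $ 2) (Y i $ 1 $ 3)" for i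
  proof (rule commuting_with_regular)
    show "Y i ** strict_upper 1 1 0 = strict_upper 1 1 0 ** Y i"
      unfolding i0[symmetric] Y_def conj D(1)[of i i0] ..
    show "Y i ** Y i ** Y i = 0"
      unfolding Y_def conj D(3) by simp
  qed
  moreover have "Y i0 $ 1 $ 2 = 1" unfolding i0 by (simp add: strict_upper_def)
  ultimately show thesis using that[OF G(1,2), of "\<lambda>i. Y i $ 1 $ 2" "\<lambda>i. Y i $ 1 $ 3"]
    unfolding Y_def by blast
qed

section \<open>Commuting square-zero tuples and surjectivity of the parametrization\<close>

definition common_image :: "('k::field ^ ('r::finite \<times> 3 \<times> 3)) set" where
  "common_image = {v. \<exists>u w. \<forall>i. mats v i = outer u (w i) \<and> dot u (w i) = 0}"

definition common_kernel :: "('k::field ^ ('r::finite \<times> 3 \<times> 3)) set" where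
  "common_kernel = {v. \<exists>u w. \<forall>i. mats v i = outer (w i) u \<and> dot u (w i) = 0}"

lemma dot_commute: "dot u w = dot w u"
  by (simp add: dot_def mult.commute)

lemma dot_scale: "dot u (c *s w) = c * dot u w"
  by (simp add: dot_def algebra_simps)

text \<open>Commuting makes every \<open>w i\<close> orthogonal to every \<open>u j\<close>. If all
  \<open>u i\<close> are parallel, they give a common image line; if two are independent, their
  orthogonal complement is a line containing all \<open>w l\<close>, which gives a common kernel
  plane.\<close>

lemma square_zero_tuple_cases:
  fixes v :: "'k::field ^ ('r::finite \<times> 3 \<times> 3)"
  assumes "v \<in> commuting_nilpotent" "\<And>i. mats v i ** mats v i = 0"
  shows "v \<in> common_image \<union> common_kernel"
proof -
  note D = commuting_nilpotentD[OF assms(1)]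
  \<comment> \<open>The zero matrix is written with \<open>u = w = 0\<close>, so that
    \<open>w i\<close> nonzero implies \<open>u i\<close> nonzero later on.\<close>
  have "\<exists>u w. mats v i = outer u w \<and> dot u w = 0 \<and> (u = 0 \<longleftrightarrow> w = 0)" for i
  proof (cases "mats v i = 0")
    case True
    then show ?thesis by (intro exI[of _ 0]) (simp add: vec_eq_iff dot_def)
  next
    case False
    then obtain u w where *: "mats v i = outer u w" "dot u w = 0"
      using square_zero_outer[OF assms(2) D(2)] by blast
    moreover have "u \<noteq> 0" "w \<noteq> 0" using False * by (auto simp: vec_eq_iff)
    ultimately show ?thesis by blast
  qed
  then obtain u w where uw: "\<And>i. mats v i = outer (u i) (w i)" "\<And>i. dot (u i) (w i) = 0"
    "\<And>i. u i = 0 \<longleftrightarrow> w i = 0"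
    by metis
  have orth: "dot (w i) (u j) = 0" for i j
  proof (rule ccontr)
    assume d: "dot (w i) (u j) \<noteq> 0"
    have comm: "dot (w i) (u j) * (u i $ a * w j $ b) = dot (w j) (u i) * (u j $ a * w i $ b)" for a b
      using D(1)[of i j] unfolding uw(1) by (metis outer_mult_nth)
    have "w i \<noteq> 0" "u j \<noteq> 0" using d by (auto simp: dot_def)
    then have nz: "u i \<noteq> 0" "w j \<noteq> 0" using uw(3) by auto
    then obtain b where b: "w j $ b \<noteq> 0" by (auto simp: vec_eq_iff)
    \<comment> \<open>The left side of the commutation relation is a nonzero matrix of rank one, so
      comparing images makes \<open>u i\<close> a multiple of \<open>u j\<close>; then
      \<open>dot (u i) (w i) = 0\<close> forces that multiple to be zero.\<close>
    define c where "c = dot (w j) (u i) * w i $ b / (dot (w i) (u j) * w j $ b)"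
    have "u i $ a = c * u j $ a" for a
      using comm[of a b] b d by (simp add: c_def field_simps)
    then have ui: "u i = c *s u j" by (simp add: vec_eq_iff)
    then have "c * dot (w i) (u j) = 0"
      using uw(2)[of i] by (simp add: dot_def algebra_simps)
    then show False using d ui nz(1) by simp
  qed
  show ?thesis
  proof (cases "\<forall>i j. cross (u i) (u j) = 0")
    case True
    show ?thesis
    proof (cases "\<forall>i. u i = 0")
      case True
      then have "v \<in> common_image"
        unfolding common_image_def using uw by (auto intro!: exI[of _ 0] exI[of _ w] simp: dot_def)
      then show ?thesis by simp
    next
      case False
      then obtain j where j: "u j \<noteq> 0" by blast
      then have "\<exists>c. u i = c *s u j" for i
        using True cross_eq_0_imp_parallel[of "u j" "u i"] by metis
      then obtain c where c: "\<And>i. u i = c i *s u j" by metis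
      have "mats v i = outer (u j) (c i *s w i)" for i
        unfolding uw(1)[of i] by (subst c) (simp add: vec_eq_iff)
      moreover have "dot (u j) (c i *s w i) = 0" for i
        using orth[of i j] by (simp add: dot_scale dot_commute)
      ultimately have "v \<in> common_image"
        unfolding common_image_def by (intro CollectI exI[of _ "u j"] exI[of _ "\<lambda>i. c i *s w i"]) blast
      then show ?thesis by blast
    qed
  next
    case False
    then obtain i j where ij: "cross (u i) (u j) \<noteq> 0" by blast
    then have "\<exists>c. w l = c *s cross (u i) (u j)" for l
      using orthogonal_to_both_imp_parallel_cross[OF orth orth ij] by metis
    then obtain c where c: "\<And>l. w l = c l *s cross (u i) (u j)" by metis
    have "mats v l = outer (c l *s u l) (cross (u i) (u j))" for l
      unfolding uw(1)[of l] by (subst c) (simp add: vec_eq_iff)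
    moreover have "dot (cross (u i) (u j)) (c l *s u l) = 0" for l
    proof -
      have "dot (cross (u i) (u j)) (c l *s u l) = dot (u l) (c l *s cross (u i) (u j))"
        by (simp add: dot_def algebra_simps)
      then show ?thesis using uw(2)[of l] c[of l] by simp
    qed
    ultimately have "v \<in> common_kernel"
      unfolding common_kernel_def
      by (intro CollectI exI[of _ "cross (u i) (u j)"] exI[of _ "\<lambda>i. c i *s u i"]) blast
    then show ?thesis by blast
  qed
qed

text \<open>Three choices of the parameters suffice: \<open>s = t = 1\<close> when some component is
  regular, \<open>s = 1\<close>, \<open>t = 0\<close> for a common image line, and
  \<open>s = 0\<close>, \<open>t = 1\<close> for a common kernel plane.\<close>

lemma commuting_nilpotent_eq_flagged:
  "(commuting_nilpotent :: ('k::field ^ ('r::finite \<times> 3 \<times> 3)) set) =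
    {flagged H s t a b |H s t a b. True}"
proof
  show "{flagged H s t a b |H s t a b. True} \<subseteq> (commuting_nilpotent :: ('k ^ ('r \<times> 3 \<times> 3)) set)"
    using flagged_in_commuting_nilpotent by auto
  show "(commuting_nilpotent :: ('k ^ ('r \<times> 3 \<times> 3)) set) \<subseteq> {flagged H s t a b |H s t a b. True}"
  proof
    fix v :: "'k ^ ('r \<times> 3 \<times> 3)"
    assume v: "v \<in> commuting_nilpotent"
    have "\<exists>H s t a b. v = flagged H s t a b"
    proof (cases "\<exists>i. mats v i ** mats v i \<noteq> 0")
      case True
      then obtain i0 where i0: "mats v i0 ** mats v i0 \<noteq> 0" by blast
      from regular_tuple_conjugate[OF v i0] obtain G G' a b where
        "G ** G' = mat 1" "G' ** G = mat 1" "\<And>i. G' ** mats v i ** G = strict_upper (a i) (a i) (b i)"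
        by metis
      then have "v = flagged G 1 1 (\<lambda>i. a i / det G) (\<lambda>i. b i / det G)"
        by (intro flagged_of_conjugate) auto
      then show ?thesis by blast
    next
      case False
      then consider u w where "\<And>i. mats v i = outer u (w i)" "\<And>i. dot u (w i) = 0"
        | u w where "\<And>i. mats v i = outer (w i) u" "\<And>i. dot u (w i) = 0"
        using square_zero_tuple_cases[OF v] unfolding common_image_def common_kernel_def by blast
      then show ?thesis
      proof cases
        case 1
        show ?thesis
        proof (cases "u = 0")
          case True
          then have "mats v i = mats (flagged 0 0 0 (\<lambda>_. 0) (\<lambda>_. 0)) i" for i
            using 1(1) by (simp add: flagged_def vec_eq_iff)
          then show ?thesis using mats_eqI by blast
        next
          case False
          obtain G G' :: "'k ^ 3 ^ 3" where G: "G ** G' = mat 1" "G' ** G = mat 1" "\<forall>i. G $ i $ 1 = u $ i"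
            by (rule invertible_with_first_column[OF False])
          have col: "(\<Sum>l\<in>UNIV. G' $ i $ l * u $ l) = (if i = 1 then 1 else 0)" for i
            using arg_cong[OF G(2), of "\<lambda>A. A $ i $ 1"] G(3)
            by (simp add: matrix_matrix_mult_def mat_def)
          define a b where "a = (\<lambda>i. dot (w i) (\<chi> l. G $ l $ 2))" and "b = (\<lambda>i. dot (w i) (\<chi> l. G $ l $ 3))"
          have "G' ** mats v i ** G = strict_upper (a i * 1) (a i * 0) (b i)" for i
          proof -
            have "(G' ** outer u (w i) ** G) $ c $ d =
                (\<Sum>l\<in>UNIV. G' $ c $ l * u $ l) * dot (w i) (\<chi> l. G $ l $ d)" for c d
              by (simp add: matrix_mult_33_nth dot_def sum_3 algebra_simps)
            moreover have "dot (w i) (\<chi> l. G $ l $ 1) = 0"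
              using 1(2)[of i] by (simp add: G(3) dot_def mult.commute)
            ultimately show ?thesis
              unfolding 1(1) col by (simp add: mat33_eq_iff strict_upper_def a_def b_def)
          qed
          then show ?thesis using flagged_of_conjugate[OF G(1,2), of v a 1 0 b] by blast
        qed
      next
        case 2
        show ?thesis
        proof (cases "u = 0")
          case True
          then have "mats v i = mats (flagged 0 0 0 (\<lambda>_. 0) (\<lambda>_. 0)) i" for i
            using 2(1) by (simp add: flagged_def vec_eq_iff)
          then show ?thesis using mats_eqI by blast
        next
          case False
          obtain P P' :: "'k ^ 3 ^ 3" where P: "P ** P' = mat 1" "P' ** P = mat 1" "\<forall>i. P $ i $ 1 = u $ i"
            by (rule invertible_with_first_column[OF False])
          \<comment> \<open>Transposing and reversing the basis with the permutation matrix
            \<open>R\<close> makes \<open>u\<close> the last row of \<open>G'\<close>, so the first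
            two columns of \<open>G\<close> span the kernel plane.\<close>
          define R where "R = mat33 0 0 1 0 1 0 (1 :: 'k) 0 0"
          define G G' where "G = transpose P' ** R" and "G' = R ** transpose P"
          have RR: "R ** R = mat 1" by (simp add: R_def m33_simps)
          have T: "transpose P' ** transpose P = mat 1" "transpose P ** transpose P' = mat 1"
            using P(1,2) by (metis matrix_transpose_mul transpose_mat)+
          have G: "G ** G' = mat 1" "G' ** G = mat 1"
            unfolding G_def G'_def using RR T by (metis matrix_mul_assoc matrix_mul_rid)+
          have G'3: "G' $ 3 $ l = u $ l" for l
            using P(3) by (simp add: G'_def R_def matrix_mult_33_nth transpose_def)
          have col: "(\<Sum>l\<in>UNIV. u $ l * G $ l $ j) = (if j = 3 then 1 else 0)" for j
            using arg_cong[OF G(2), of "\<lambda>A. A $ 3 $ j"] G'3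
            by (auto simp add: matrix_matrix_mult_def mat_def)
          define a b where "a = (\<lambda>i. dot (\<chi> l. G' $ 2 $ l) (w i))" and "b = (\<lambda>i. dot (\<chi> l. G' $ 1 $ l) (w i))"
          have "G' ** mats v i ** G = strict_upper (a i * 0) (a i * 1) (b i)" for i
          proof -
            have "(G' ** outer (w i) u ** G) $ c $ d =
                dot (\<chi> l. G' $ c $ l) (w i) * (\<Sum>l\<in>UNIV. u $ l * G $ l $ d)" for c d
              by (simp add: matrix_mult_33_nth dot_def sum_3 algebra_simps)
            moreover have "dot (\<chi> l. G' $ 3 $ l) (w i) = 0"
              using 2(2)[of i] by (simp add: G'3 dot_def)
            ultimately show ?thesis
              unfolding 2(1) col by (simp add: mat33_eq_iff strict_upper_def a_def b_def)
          qed
          then show ?thesis using flagged_of_conjugate[OF G, of v a 0 1 b] by blast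
        qed
      qed
    qed
    then show "v \<in> {flagged H s t a b |H s t a b. True}" by blast
  qed
qed

text \<open>For distinct indices these equations are not part of the definition; they come from the
  common flag, where three strictly upper triangular factors multiply to zero.\<close>

lemma commuting_nilpotent_triple:
  fixes v :: "'k::field ^ ('r::finite \<times> 3 \<times> 3)"
  assumes "v \<in> commuting_nilpotent"
  shows "mats v i ** mats v j ** mats v k = 0"
proof -
  obtain H s t a b where "v = flagged H s t a b"
    using assms unfolding commuting_nilpotent_eq_flagged by blast
  then show ?thesis by (simp add: flagged_triple)
qed

section \<open>Symmetries and tangent spaces\<close>

text \<open>For lower bounds on tangent spaces: a polynomial vanishing on \<open>X\<close> is
  constantly zero along the curve, and so has velocity zero.\<close>

lemma tangent_space_of_curve:
  fixes c :: "'k::alg_closed_field \<Rightarrow> 'k ^ 'n::finite"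
  assumes "\<And>i. polyvel (\<lambda>t. c t $ i) (w $ i)" "\<And>t. c t \<in> X"
  shows "w \<in> tangent_space X (c 0)"
  unfolding tangent_space_def
proof (intro CollectI ballI)
  fix f assume "f \<in> vanishing_ideal X"
  then have "mveval f (c t) = 0" for t using assms(2) unfolding vanishing_ideal_def by blast
  then have "(\<lambda>t. mveval f (c t)) = (\<lambda>t. 0)" by simp
  then have "polyvel (\<lambda>t. mveval f (c t)) 0" using polyvel_const[of "0 :: 'k"] by simp
  then show "(\<Sum>i\<in>UNIV. mveval (mvpderiv i f) (c 0) * w $ i) = 0"
    by (rule polyvel_unique[OF polyvel_mveval[OF assms(1)]])
qed

lemma polyvel_line: "polyvel (\<lambda>t. (x + t *s w) $ i) (w $ i)"
  using polyvel_add[OF polyvel_const[of "x $ i"] polyvel_mult[OF polyvel_id polyvel_const[of "w $ i"]]]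
  by simp

text \<open>For upper bounds on tangent spaces: the linear term of an equation is found by
  substituting a line, without writing the equation as a formal polynomial.\<close>

lemma tangent_space_polyvel:
  fixes X :: "('k::alg_closed_field ^ 'n::finite) set"
  assumes "w \<in> tangent_space X x" "polyfun h" "\<And>z. z \<in> X \<Longrightarrow> h z = 0"
    "polyvel (\<lambda>t. h (x + t *s w)) d"
  shows "d = 0"
proof -
  obtain f where f: "h = mveval f" using assms(2) polyfun_def by blast
  then have "f \<in> vanishing_ideal X" using assms(3) by (simp add: vanishing_ideal_def)
  then have "(\<Sum>i\<in>UNIV. mveval (mvpderiv i f) x * w $ i) = 0"
    using assms(1) by (simp add: tangent_space_def)
  moreover have "polyvel (\<lambda>t. h (x + t *s w)) (\<Sum>i\<in>UNIV. mveval (mvpderiv i f) x * w $ i)"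
    using polyvel_mveval[of "\<lambda>t. x + t *s w" w f] polyvel_line f by fastforce
  ultimately show ?thesis using polyvel_unique[OF assms(4)] by simp
qed

lemma subspace_tangent_space: "vec.subspace (tangent_space X x)"
  unfolding vec.subspace_def tangent_space_def
  by (auto simp: distrib_left sum.distrib mult.left_commute[of _ "_ :: 'a"] simp flip: sum_distrib_left)

section \<open>Linear symmetries\<close>

definition linear_symmetry :: "('k::field ^ 'n::finite) set \<Rightarrow> ('k ^ 'n \<Rightarrow> 'k ^ 'n) \<Rightarrow> ('k ^ 'n \<Rightarrow> 'k ^ 'n) \<Rightarrow> bool" where
  "linear_symmetry X g g' \<longleftrightarrow> Vector_Spaces.linear (*s) (*s) g \<and> Vector_Spaces.linear (*s) (*s) g' \<and>
    (\<forall>x. g (g' x) = x) \<and> (\<forall>x. g' (g x) = x) \<and> g ` X \<subseteq> X \<and> g' ` X \<subseteq> X"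

lemma linear_symmetry_sym: "linear_symmetry X g g' \<Longrightarrow> linear_symmetry X g' g"
  by (simp add: linear_symmetry_def)

lemma polyfun_linear:
  assumes "Vector_Spaces.linear (*s) (*s) g"
  shows "polyfun (\<lambda>x. g x $ i)"
proof -
  have "g x $ i = (\<Sum>j\<in>UNIV. matrix g $ i $ j * x $ j)" for x
    unfolding matrix_works[OF assms, of x, symmetric] by (simp add: matrix_vector_mult_def)
  then show ?thesis by (simp add: polyfun_sum polyfun_mult polyfun_const polyfun_coord)
qed

text \<open>The equations of the image are those of \<open>Z\<close> composed with the inverse
  symmetry.\<close>

lemma linear_symmetry_image_closedin:
  assumes "linear_symmetry X g g'" "closedin (zar X) Z"
  shows "closedin (zar X) (g ` Z)"
proof -
  obtain S where S: "Z = X \<inter> zero_locus S" using assms(2) closedin_zar by blast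
  define S' where "S' = {f'. \<exists>f\<in>S. mveval f' = (\<lambda>x. mveval f (g' x))}"
  have ex: "\<exists>f'. mveval f' = (\<lambda>x. mveval f (g' x))" for f
    using polyfun_comp[OF polyfun_mveval[of f] polyfun_linear] assms(1)
    unfolding linear_symmetry_def polyfun_def by metis
  have "g ` Z = X \<inter> zero_locus S'"
  proof
    show "g ` Z \<subseteq> X \<inter> zero_locus S'"
      using assms(1) unfolding S S'_def zero_locus_def linear_symmetry_def by auto
    show "X \<inter> zero_locus S' \<subseteq> g ` Z"
    proof
      fix x assume x: "x \<in> X \<inter> zero_locus S'"
      have "mveval f (g' x) = 0" if f: "f \<in> S" for f
      proof -
        obtain f' where f': "mveval f' = (\<lambda>x. mveval f (g' x))" using ex by blast
        then have "f' \<in> S'" using f S'_def by blast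
        then have "mveval f' x = 0" using x unfolding zero_locus_def by blast
        then show ?thesis using f' by simp
      qed
      moreover have "g' x \<in> X" using x assms(1) unfolding linear_symmetry_def by blast
      ultimately have "g' x \<in> Z" by (simp add: S zero_locus_def)
      moreover have "x = g (g' x)" using assms(1) unfolding linear_symmetry_def by simp
      ultimately show "x \<in> g ` Z" by blast
    qed
  qed
  then show ?thesis using closedin_zar by blast
qed

lemma linear_symmetry_image_irreducible:
  assumes "linear_symmetry X g g'" "irreducible_closed (zar X) Z"
  shows "irreducible_closed (zar X) (g ` Z)"
proof -
  have Z: "closedin (zar X) Z" "Z \<noteq> {}"
    and irr: "\<And>A B. closedin (zar X) A \<Longrightarrow> closedin (zar X) B \<Longrightarrow> Z = A \<union> B \<Longrightarrow> Z = A \<or> Z = B"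
    using assms(2) unfolding irreducible_closed_def by blast+
  have inv: "g ` g' ` A = A" "g' ` g ` A = A" for A
    using assms(1) by (auto simp: linear_symmetry_def image_image)
  show ?thesis
    unfolding irreducible_closed_def
  proof (intro conjI allI impI)
    show "closedin (zar X) (g ` Z)" by (rule linear_symmetry_image_closedin[OF assms(1) Z(1)])
    show "g ` Z \<noteq> {}" using Z(2) by simp
    fix A B assume AB: "closedin (zar X) A \<and> closedin (zar X) B \<and> g ` Z = A \<union> B"
    then have "Z = g' ` A \<union> g' ` B" using inv(2)[of Z] by (simp add: image_Un)
    moreover have "closedin (zar X) (g' ` A)" "closedin (zar X) (g' ` B)"
      using AB linear_symmetry_image_closedin[OF linear_symmetry_sym[OF assms(1)]] by auto
    ultimately have "Z = g' ` A \<or> Z = g' ` B" using irr by blast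
    then have "g ` Z = g ` g' ` A \<or> g ` Z = g ` g' ` B" by blast
    then show "g ` Z = A \<or> g ` Z = B" unfolding inv(1) .
  qed
qed

lemma linear_symmetry_image_chain:
  assumes "linear_symmetry X g g'" "closed_chain (zar X) n C"
  shows "closed_chain (zar X) n (\<lambda>i. g ` C i)"
proof -
  have "inj g" using assms(1) unfolding linear_symmetry_def by (metis injI)
  then have "g ` A \<subset> g ` B" if "A \<subset> B" for A B
    using that by (meson image_strict_mono inj_on_subset subset_UNIV)
  then show ?thesis
    using assms(2) linear_symmetry_image_irreducible[OF assms(1)] unfolding closed_chain_def by simp
qed

lemma linear_symmetry_tangent_space:
  fixes X :: "('k::alg_closed_field ^ 'n::finite) set"
  assumes "linear_symmetry X g g'"
  shows "g ` tangent_space X x \<subseteq> tangent_space X (g x)"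
proof
  fix v assume "v \<in> g ` tangent_space X x"
  then obtain w where w: "w \<in> tangent_space X x" "v = g w" by blast
  have lin: "Vector_Spaces.linear (*s) (*s) g" using assms linear_symmetry_def by blast
  have line: "g (x + t *s w) = g x + t *s v" for t
    using lin by (simp add: w(2) vec.linear_add vec.linear_scale)
  show "v \<in> tangent_space X (g x)"
    unfolding tangent_space_def
  proof (intro CollectI ballI)
    fix f assume f: "f \<in> vanishing_ideal X"
    have "polyfun (\<lambda>x. mveval f (g x))"
      by (rule polyfun_comp[OF polyfun_mveval polyfun_linear[OF lin]])
    moreover have "mveval f (g z) = 0" if "z \<in> X" for z
      using that f assms unfolding vanishing_ideal_def linear_symmetry_def by blast
    moreover have "polyvel (\<lambda>t. mveval f (g (x + t *s w)))
        (\<Sum>i\<in>UNIV. mveval (mvpderiv i f) (g x + 0 *s v) * v $ i)"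
      unfolding line by (rule polyvel_mveval[OF polyvel_line])
    ultimately have "(\<Sum>i\<in>UNIV. mveval (mvpderiv i f) (g x + 0 *s v) * v $ i) = 0"
      by (rule tangent_space_polyvel[OF w(1)])
    then show "(\<Sum>i\<in>UNIV. mveval (mvpderiv i f) (g x) * v $ i) = 0" by simp
  qed
qed

lemma linear_symmetry_dim_tangent_space:
  fixes X :: "('k::alg_closed_field ^ 'n::finite) set"
  assumes "linear_symmetry X g g'"
  shows "vec.dim (tangent_space X (g x)) = vec.dim (tangent_space X x)"
proof -
  have le: "vec.dim (tangent_space X x) \<le> vec.dim (tangent_space X (h x))"
    if h: "linear_symmetry X h h'" for h h' x
  proof -
    have "inj h" using h unfolding linear_symmetry_def by (metis injI)
    then have "vec.dim (h ` tangent_space X x) = vec.dim (tangent_space X x)"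
      using h unfolding linear_symmetry_def by (intro vec.dim_image_eq) (auto intro: inj_on_subset)
    then show ?thesis
      using vec.dim_subset[OF linear_symmetry_tangent_space[OF h, of x]] by simp
  qed
  have "g' (g x) = x" using assms linear_symmetry_def by blast
  then show ?thesis
    using le[OF assms, of x] le[OF linear_symmetry_sym[OF assms], of "g x"] by simp
qed

section \<open>Irreducible families of flagged tuples\<close>

text \<open>An arbitrary class \<open>Q\<close> closed under ring operations lets one argument serve
  both polynomial functions on affine space and polynomial functions of a curve parameter.\<close>

lemma flagged_nth_closure:
  assumes const: "\<And>c. Q (\<lambda>x. c)"
    and add: "\<And>f g. Q f \<Longrightarrow> Q g \<Longrightarrow> Q (\<lambda>x. f x + g x)"
    and diff: "\<And>f g. Q f \<Longrightarrow> Q g \<Longrightarrow> Q (\<lambda>x. f x - g x)"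
    and mult: "\<And>f g. Q f \<Longrightarrow> Q g \<Longrightarrow> Q (\<lambda>x. f x * g x)"
    and H: "\<And>i j. Q (\<lambda>x. H x $ i $ j)" and s: "Q s" "Q t"
    and a: "\<And>i. Q (\<lambda>x. a x i)" "\<And>i. Q (\<lambda>x. b x i)"
  shows "Q (\<lambda>x. (flagged (H x) (s x) (t x) (a x) (b x) :: 'k::comm_ring_1 ^ ('r::finite \<times> 3 \<times> 3)) $ p)"
proof -
  have mm: "Q (\<lambda>x. (A x ** B x) $ i $ j)"
    if "\<And>i j. Q (\<lambda>x. A x $ i $ j)" "\<And>i j. Q (\<lambda>x. B x $ i $ j)" for A B :: "_ \<Rightarrow> 'k ^ 3 ^ 3" and i j
    unfolding matrix_mult_33_nth by (intro add mult that)
  have adj: "Q (\<lambda>x. adj3 (H x) $ i $ j)" for i j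
    using exhaust_3[of i] exhaust_3[of j] by (auto simp: adj3_def intro!: diff mult H)
  have su: "Q (\<lambda>x. strict_upper (a x i * s x) (a x i * t x) (b x i) $ k $ l)" for i k l
    using exhaust_3[of k] exhaust_3[of l] by (auto simp: strict_upper_def intro!: mult const a s)
  obtain i k l where "p = (i, k, l)" by (metis surj_pair)
  then show ?thesis
    by (simp add: flagged_def tup_nth mm H adj su)
qed

definition segment_matrix :: "'k::comm_ring_1 ^ 3 ^ 3 \<Rightarrow> 'k ^ 3 ^ 3 \<Rightarrow> 'k \<Rightarrow> 'k ^ 3 ^ 3" where
  "segment_matrix H H' l = (\<chi> i j. (1 - l) * H $ i $ j + l * H' $ i $ j)"

abbreviation segment :: "'k::comm_ring_1 \<Rightarrow> 'k \<Rightarrow> 'k \<Rightarrow> 'k" where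
  "segment x y l \<equiv> (1 - l) * x + l * y"

lemma segment_matrix_nth [simp]: "segment_matrix H H' l $ i $ j = segment (H $ i $ j) (H' $ i $ j) l"
  by (simp add: segment_matrix_def)

lemma segment_matrix_ends [simp]: "segment_matrix H H' 0 = H" "segment_matrix H H' 1 = H'"
  "segment_matrix H H l = H"
  by (simp_all add: vec_eq_iff algebra_simps)

definition flagged_segment where
  "flagged_segment H s t a b H' s' t' a' b' l =
    flagged (segment_matrix H H' l) (segment s s' l) (segment t t' l)
      (\<lambda>i. segment (a i) (a' i) l) (\<lambda>i. segment (b i) (b' i) l)"

lemma polycurve_flagged_segment: "polycurve (flagged_segment H s t a b H' s' t' a' b')"
  unfolding polycurve_def flagged_segment_def
  by (intro allI, rule flagged_nth_closure[where Q = poly1]) (auto intro!: poly1_intros)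

text \<open>The segments are straight in the parameters and polynomial in the tuples, so affine
  linear conditions on the parameters give irreducible closures.\<close>

lemma poly_connected_flagged:
  fixes P :: "'k::field ^ 3 ^ 3 \<Rightarrow> 'k \<Rightarrow> 'k \<Rightarrow> ('r::finite \<Rightarrow> 'k) \<Rightarrow> ('r \<Rightarrow> 'k) \<Rightarrow> bool"
  assumes "P H0 s0 t0 a0 b0"
    and "\<And>H s t a b H' s' t' a' b' l. P H s t a b \<Longrightarrow> P H' s' t' a' b' \<Longrightarrow>
      P (segment_matrix H H' l) (segment s s' l) (segment t t' l)
      (\<lambda>i. segment (a i) (a' i) l) (\<lambda>i. segment (b i) (b' i) l)"
  shows "poly_connected {flagged H s t a b |H s t a b. P H s t a b}"
  unfolding poly_connected_def
proof (intro conjI ballI)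
  show "{flagged H s t a b |H s t a b. P H s t a b} \<noteq> {}" using assms(1) by blast
  fix v v' assume "v \<in> {flagged H s t a b |H s t a b. P H s t a b}"
    and "v' \<in> {flagged H s t a b |H s t a b. P H s t a b}"
  then obtain H s t a b H' s' t' a' b' where *: "P H s t a b" "P H' s' t' a' b'"
    "v = flagged H s t a b" "v' = flagged H' s' t' a' b'" by blast
  show "\<exists>c. polycurve c \<and> range c \<subseteq> {flagged H s t a b |H s t a b. P H s t a b} \<and> c 0 = v \<and> c 1 = v'"
  proof (intro exI[of _ "flagged_segment H s t a b H' s' t' a' b'"] conjI)
    show "range (flagged_segment H s t a b H' s' t' a' b') \<subseteq> {flagged H s t a b |H s t a b. P H s t a b}"
      using assms(2)[OF *(1,2)] unfolding flagged_segment_def by blast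
  qed (simp_all add: polycurve_flagged_segment, simp_all add: flagged_segment_def *)
qed

abbreviation flagged_set where
  "flagged_set P \<equiv> {flagged H s t a b |H s t a b. P H s t a b}"

lemma flagged_set_subset: "flagged_set P \<subseteq> commuting_nilpotent"
  using flagged_in_commuting_nilpotent by blast

section \<open>The local dimension at regular tuples\<close>

definition lower_unitriangular :: "'k::zero_neq_one \<Rightarrow> 'k \<Rightarrow> 'k \<Rightarrow> 'k ^ 3 ^ 3" where
  "lower_unitriangular x y z = mat33 1 0 0 x 1 0 y z 1"

text \<open>A parametrization with as many parameters as the dimension, using the big cell of the flag variety.\<close>

definition chart :: "'k::comm_ring_1 ^ (4 + 'r + 'r) \<Rightarrow> 'k ^ ('r::finite \<times> 3 \<times> 3)" where
  "chart y = flagged (lower_unitriangular (y $ Inl 1) (y $ Inl 2) (y $ Inl 3)) 1 (y $ Inl 4)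
     (\<lambda>i. y $ Inr (Inl i)) (\<lambda>i. y $ Inr (Inr i))"

lemma polyfun_chart: "polyfun (\<lambda>y. chart y $ p)"
  unfolding chart_def
proof (rule flagged_nth_closure)
  show "polyfun (\<lambda>y. lower_unitriangular (y $ Inl 1) (y $ Inl 2) (y $ Inl 3) $ i $ j)" for i j
    using exhaust_3[of i] exhaust_3[of j]
    by (auto simp: lower_unitriangular_def intro: polyfun_const polyfun_coord)
qed (auto intro: polyfun_const polyfun_coord polyfun_add polyfun_diff polyfun_mult)

text \<open>LU decomposition of \<open>H\<close>; the upper triangular factor only rescales the strictly upper triangular matrices.\<close>

lemma flagged_in_range_chart:
  fixes H :: "'k::field ^ 3 ^ 3" and a b :: "'r::finite \<Rightarrow> 'k"
  assumes "H $ 1 $ 1 \<noteq> 0" "H $ 1 $ 1 * H $ 2 $ 2 - H $ 1 $ 2 * H $ 2 $ 1 \<noteq> 0" "det H \<noteq> 0" "s \<noteq> 0"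
  shows "flagged H s t a b \<in> range chart"
proof -
  define x where "x = H $ 2 $ 1 / H $ 1 $ 1"
  define y where "y = H $ 3 $ 1 / H $ 1 $ 1"
  define u22 where "u22 = H $ 2 $ 2 - x * H $ 1 $ 2"
  define u23 where "u23 = H $ 2 $ 3 - x * H $ 1 $ 3"
  have "H $ 1 $ 1 * u22 = H $ 1 $ 1 * H $ 2 $ 2 - H $ 1 $ 2 * H $ 2 $ 1"
    using assms(1) by (simp add: u22_def x_def field_simps)
  then have u22: "u22 \<noteq> 0" using assms(2) by auto
  define z where "z = (H $ 3 $ 2 - y * H $ 1 $ 2) / u22"
  define u33 where "u33 = H $ 3 $ 3 - y * H $ 1 $ 3 - z * u23"
  define L where "L = lower_unitriangular x y z"
  define U where "U = mat33 (H $ 1 $ 1) (H $ 1 $ 2) (H $ 1 $ 3) 0 u22 u23 0 0 u33"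
  have x: "x * H $ 1 $ 1 = H $ 2 $ 1" and y: "y * H $ 1 $ 1 = H $ 3 $ 1" and z: "z * u22 = H $ 3 $ 2 - y * H $ 1 $ 2"
    using assms(1) u22 by (auto simp: x_def y_def z_def)
  have LU: "H = L ** U"
    using x y z by (simp add: L_def U_def lower_unitriangular_def m33_simps u22_def u23_def u33_def)
  have "det U \<noteq> 0" using assms(3) unfolding LU det_mul by auto
  then have u33: "u33 \<noteq> 0" by (auto simp: U_def det_3)
  \<comment> \<open>Conjugation by \<open>U\<close>, with the adjugate as inverse, multiplies the
    two superdiagonal entries by \<open>c\<close> and \<open>d\<close>. Absorbing
    \<open>c * s\<close> into the coefficients normalizes \<open>s\<close> to 1 and turns
    \<open>t\<close> into \<open>d * t / (c * s)\<close>.\<close>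
  define c where "c = H $ 1 $ 1 * (H $ 1 $ 1 * u33)"
  define d where "d = u22 * (H $ 1 $ 1 * u22)"
  have c: "c \<noteq> 0" using assms(1) u33 by (simp add: c_def)
  define b' where "b' = (\<lambda>i. (U ** strict_upper (a i * s) (a i * t) (b i) ** adj3 U) $ 1 $ 3)"
  have conj: "U ** strict_upper (a i * s) (a i * t) (b i) ** adj3 U =
      strict_upper ((c * a i * s) * 1) ((c * a i * s) * (d * t / (c * s))) (b' i)" for i
    using c assms(4)
    by (simp add: b'_def mat33_eq_iff) (simp add: matrix_mult_33_nth U_def adj3_def strict_upper_def c_def d_def)
  define v :: "'k ^ (4 + 'r + 'r)" where "v = (\<chi> q. case q of Inl j \<Rightarrow> (if j = 1 then x else if j = 2 then y else if j = 3 then z else d * t / (c * s))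
    | Inr (Inl i) \<Rightarrow> c * a i * s | Inr (Inr i) \<Rightarrow> b' i)"
  have "flagged H s t a b = chart v"
  proof (rule mats_eqI)
    fix i
    have "mats (flagged H s t a b) i = L ** (U ** strict_upper (a i * s) (a i * t) (b i) ** adj3 U) ** adj3 L"
      unfolding LU by (simp add: flagged_def adj3_matrix_mult matrix_mul_assoc)
    then show "mats (flagged H s t a b) i = mats (chart v) i"
      unfolding conj by (simp add: chart_def flagged_def v_def L_def)
  qed
  then show ?thesis by blast
qed

text \<open>Every tuple is the start of a curve whose general point lies in the chart, so a
  polynomial vanishing on the chart vanishes along the whole curve.\<close>

lemma range_chart_dense:
  fixes v :: "'k::alg_closed_field ^ ('r::finite \<times> 3 \<times> 3)"
  assumes "polyfun h" "\<And>y. h (chart y) = 0" "v \<in> commuting_nilpotent"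
  shows "h v = 0"
proof -
  obtain H s t a b where v: "v = flagged H s t a b"
    using assms(3) unfolding commuting_nilpotent_eq_flagged by blast
  define c where "c = flagged_segment H s t a b (mat 1) 1 1 a b"
  let ?H = "segment_matrix H (mat 1)"
  \<comment> \<open>The product of all quantities that must be nonzero for the LU decomposition; at
    \<open>l = 1\<close> the matrix is the identity and \<open>s\<close> is 1, so \<open>q\<close>
    is not the zero polynomial.\<close>
  define q where "q = (\<lambda>l. ?H l $ 1 $ 1 * (?H l $ 1 $ 1 * ?H l $ 2 $ 2 - ?H l $ 1 $ 2 * ?H l $ 2 $ 1) *
    (det (?H l) * segment s 1 l))"
  have "h (c l) * q l = 0" for l
  proof (cases "q l = 0")
    case False
    then have "c l \<in> range chart"
      unfolding c_def flagged_segment_def q_def by (intro flagged_in_range_chart) auto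
    then show ?thesis using assms(2) by auto
  qed simp
  moreover have "poly1 q"
    unfolding q_def det_3 segment_matrix_nth by (intro poly1_intros)
  moreover have "poly1 (\<lambda>l. h (c l))"
    unfolding c_def by (intro polycurve_polyfun polycurve_flagged_segment assms(1))
  moreover have "q 1 \<noteq> 0"
    by (simp add: q_def mat_33_nth)
  ultimately have "h (c 0) = 0" using poly1_cover by blast
  then show ?thesis by (simp add: c_def flagged_segment_def v)
qed

lemma commuting_nilpotent_chain_le:
  fixes Z :: "nat \<Rightarrow> ('k::alg_closed_field ^ ('r::finite \<times> 3 \<times> 3)) set"
  assumes "closed_chain (zar commuting_nilpotent) m Z"
  shows "m \<le> 4 + 2 * CARD('r)"
proof -
  have "m \<le> CARD(4 + 'r + 'r)"
    by (rule closed_chain_length_le[where g = chart, OF _ _ assms])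
      (use polyfun_chart range_chart_dense in blast)+
  then show ?thesis by simp
qed

lemma closed_chain_flagged_Suc:
  fixes P :: "'k::alg_closed_field ^ 3 ^ 3 \<Rightarrow> 'k \<Rightarrow> 'k \<Rightarrow> ('r::finite \<Rightarrow> 'k) \<Rightarrow> ('r \<Rightarrow> 'k) \<Rightarrow> bool"
  assumes "\<exists>Z. closed_chain (zar commuting_nilpotent) n Z \<and> x \<in> Z 0 \<and>
      Z n = zar commuting_nilpotent closure_of (flagged_set P)"
    and "\<And>H s t a b. P H s t a b \<Longrightarrow> P' H s t a b"
    and "\<And>H s t a b H' s' t' a' b' l. P' H s t a b \<Longrightarrow> P' H' s' t' a' b' \<Longrightarrow>
      P' (segment_matrix H H' l) (segment s s' l) (segment t t' l)
      (\<lambda>i. segment (a i) (a' i) l) (\<lambda>i. segment (b i) (b' i) l)"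
    and "polyfun h" "\<And>H s t a b. P H s t a b \<Longrightarrow> h (flagged H s t a b) = 0"
    and "P' H s t a b" "h (flagged H s t a b) \<noteq> 0"
  shows "\<exists>Z. closed_chain (zar commuting_nilpotent) (Suc n) Z \<and> x \<in> Z 0 \<and>
      Z (Suc n) = zar commuting_nilpotent closure_of (flagged_set P')"
proof -
  obtain Z where Z: "closed_chain (zar commuting_nilpotent) n Z" "x \<in> Z 0"
    "Z n = zar commuting_nilpotent closure_of (flagged_set P)" using assms(1) by blast
  let ?Z' = "zar commuting_nilpotent closure_of (flagged_set P')"
  have irr: "irreducible_closed (zar commuting_nilpotent) ?Z'"
    by (intro irreducible_closure_of_poly_connected poly_connected_flagged flagged_set_subset)
      (use assms(3,6) in auto)
  have "Z n \<subset> ?Z'"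
    unfolding Z(3)
  proof (rule closure_of_psubset[OF _ assms(4) _ _ flagged_in_commuting_nilpotent assms(7)])
    show "flagged_set P \<subseteq> flagged_set P'" using assms(2) by blast
    show "flagged H s t a b \<in> flagged_set P'" using assms(6) by blast
    show "h v = 0" if "v \<in> flagged_set P" for v using that assms(5) by blast
  qed
  then show ?thesis
    using closed_chain_Suc[OF Z(1) irr] Z(2) by (intro exI[of _ "Z(Suc n := ?Z')"]) auto
qed

lemma adj3_mat_1 [simp]: "adj3 (mat 1) = mat 1"
  by (simp add: adj3_def m33_simps)

lemma flagged_mat_1_nth:
  "flagged (mat 1) s t a b $ (i, k, l) = strict_upper (a i * s) (a i * t) (b i) $ k $ l"
  by (simp add: flagged_def tup_nth)

lemma segment_same [simp]: "segment x x l = x"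
  by (simp add: algebra_simps)

lemma polyfun_nth_diff_const: "polyfun (\<lambda>v. v $ p - c)"
  by (intro polyfun_diff polyfun_coord polyfun_const)

text \<open>\<open>B\<close> collects the coefficients already set free, \<open>Inl i\<close> for
  \<open>a i\<close> and \<open>Inr i\<close> for \<open>b i\<close>. Each new one is detected by a
  single matrix entry, while the others stay at their base values.\<close>

lemma standard_chain_linear:
  fixes a0 b0 :: "'r::finite \<Rightarrow> 'k::alg_closed_field" and B :: "('r + 'r) set"
  shows "\<exists>Z. closed_chain (zar commuting_nilpotent) (card B) Z \<and> flagged (mat 1) 1 1 a0 b0 \<in> Z 0 \<and>
     Z (card B) = zar commuting_nilpotent closure_of (flagged_set (\<lambda>H s t a b. H = mat 1 \<and> s = 1 \<and> t = 1 \<and>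
       (\<forall>i. Inl i \<notin> B \<longrightarrow> a i = a0 i) \<and> (\<forall>i. Inr i \<notin> B \<longrightarrow> b i = b0 i)))"
proof -
  let ?P = "\<lambda>B (H :: 'k ^ 3 ^ 3) (s :: 'k) (t :: 'k) (a :: 'r \<Rightarrow> 'k) (b :: 'r \<Rightarrow> 'k).
       H = mat 1 \<and> s = 1 \<and> t = 1 \<and>
       (\<forall>i. Inl i \<notin> B \<longrightarrow> a i = a0 i) \<and> (\<forall>i. Inr i \<notin> B \<longrightarrow> b i = b0 i)"
  have "finite B" by simp
  then show ?thesis
  proof (induction B rule: finite_induct)
    case empty
    let ?S = "flagged_set (?P {})"
    have "poly_connected ?S"
      by (rule poly_connected_flagged[of _ "mat 1" 1 1 a0 b0]) (auto simp: algebra_simps)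
    then have "irreducible_closed (zar commuting_nilpotent) (zar commuting_nilpotent closure_of ?S)"
      by (rule irreducible_closure_of_poly_connected[OF _ flagged_set_subset])
    moreover have "flagged (mat 1) 1 1 a0 b0 \<in> zar commuting_nilpotent closure_of ?S"
      by (rule subsetD[OF closure_of_subset]) (auto simp: flagged_in_commuting_nilpotent)
    ultimately show ?case
      using closed_chain_0 by (intro exI[of _ "\<lambda>_. zar commuting_nilpotent closure_of ?S"]) auto
  next
    case (insert c B)
    have seg: "?P B' (segment_matrix H H' l) (segment s s' l) (segment t t' l)
      (\<lambda>i. segment (a i) (a' i) l) (\<lambda>i. segment (b i) (b' i) l)"
      if "?P B' H s t a b" "?P B' H' s' t' a' b'" for B' H s t a b H' s' t' a' b' l
      using that by (auto simp: algebra_simps)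
    show ?case
    proof (cases c)
      case (Inl i)
      show ?thesis
        unfolding card_insert_disjoint[OF insert.hyps]
        by (rule closed_chain_flagged_Suc[OF insert.IH, of _ "\<lambda>v. v $ (i, 1, 2) - a0 i"
              "mat 1" 1 1 "a0(i := a0 i + 1)" b0])
          (use insert.hyps in \<open>auto simp: Inl seg polyfun_nth_diff_const flagged_mat_1_nth strict_upper_def\<close>)
    next
      case (Inr i)
      show ?thesis
        unfolding card_insert_disjoint[OF insert.hyps]
        by (rule closed_chain_flagged_Suc[OF insert.IH, of _ "\<lambda>v. v $ (i, 1, 3) - b0 i"
              "mat 1" 1 1 a0 "b0(i := b0 i + 1)"])
          (use insert.hyps in \<open>auto simp: Inr seg polyfun_nth_diff_const flagged_mat_1_nth strict_upper_def\<close>)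
    qed
  qed
qed

text \<open>
  After the linear steps the chain frees the parameter \<open>t\<close>, then the plane of the flag, then its line
  within a fixed plane, and finally the whole flag.
\<close>

lemma standard_chain:
  fixes a0 b0 :: "'r::finite \<Rightarrow> 'k::alg_closed_field"
  shows "\<exists>Z. closed_chain (zar commuting_nilpotent) (4 + 2 * CARD('r)) Z \<and>
    flagged (mat 1) 1 1 a0 b0 \<in> Z 0"
proof -
  let ?x = "flagged (mat 1) 1 1 a0 b0"
  let ?ch = "\<lambda>n P. \<exists>Z. closed_chain (zar commuting_nilpotent) n Z \<and> ?x \<in> Z 0 \<and>
     Z n = zar commuting_nilpotent closure_of (flagged_set P)"
  define n where "n = 2 * CARD('r)"
  obtain i0 :: 'r where True by simp
  have "?ch n (\<lambda>H s t a b. H = mat 1 \<and> s = 1 \<and> t = 1)"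
    using standard_chain_linear[of "UNIV :: ('r + 'r) set" a0 b0] by (simp add: n_def mult_2)
  \<comment> \<open>Comparing the two superdiagonal entries detects whether
    \<open>s = t\<close>.\<close>
  then have "?ch (Suc n) (\<lambda>H s t a b. H = mat 1)"
    by (rule closed_chain_flagged_Suc[where h = "\<lambda>v. v $ (i0, 1, 2) - v $ (i0, 2, 3)"
          and H = "mat 1" and s = 1 and t = 0 and a = "\<lambda>_. 1" and b = "\<lambda>_. 0"])
      (auto intro!: polyfun_diff polyfun_coord simp: flagged_mat_1_nth strict_upper_def)
  \<comment> \<open>So far all matrices are upper triangular; interchanging the last two basis
    vectors moves the plane of the flag and keeps its line.\<close>
  then have "?ch (Suc (Suc n)) (\<lambda>H s t a b. H $ 2 $ 1 = 0 \<and> H $ 3 $ 1 = 0)"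
    by (rule closed_chain_flagged_Suc[where h = "\<lambda>v. v $ (i0, 3, 2)"
          and H = "mat33 1 0 0 0 0 1 0 1 0" and s = 0 and t = 1 and a = "\<lambda>_. 1" and b = "\<lambda>_. 0"])
      (auto intro!: polyfun_coord simp: flagged_def tup_nth strict_upper_def adj3_def m33_simps)
  \<comment> \<open>The old conditions make the first column of every matrix vanish; the witness
    interchanges the first two basis vectors.\<close>
  then have "?ch (Suc (Suc (Suc n))) (\<lambda>H s t a b. H $ 3 $ 1 = 0)"
    by (rule closed_chain_flagged_Suc[where h = "\<lambda>v. v $ (i0, 2, 1)"
          and H = "mat33 0 1 0 1 0 0 0 0 1" and s = 1 and t = 0 and a = "\<lambda>_. 1" and b = "\<lambda>_. 0"])
      (auto intro!: polyfun_coord simp: flagged_def tup_nth strict_upper_def adj3_def m33_simps)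
  \<comment> \<open>The columns of a square are multiples of the first column of \<open>H\<close>,
    so the old condition kills its third row; the cyclic permutation moves the line of the flag to
    the third axis.\<close>
  then have "?ch (Suc (Suc (Suc (Suc n)))) (\<lambda>H s t a b. True)"
  proof (rule closed_chain_flagged_Suc[where h = "\<lambda>v. (mats v i0 ** mats v i0) $ 3 $ 2"
          and H = "mat33 0 1 0 0 0 1 1 0 0" and s = 1 and t = 1 and a = "\<lambda>_. 1" and b = "\<lambda>_. 0"])
    show "polyfun (\<lambda>v :: 'k ^ ('r \<times> 3 \<times> 3). (mats v i0 ** mats v i0) $ 3 $ 2)"
      unfolding matrix_mult_33_nth mats_nth by (intro polyfun_add polyfun_mult polyfun_coord)
  qed (auto simp: flagged_mult, auto simp: strict_upper_def adj3_def m33_simps det_3)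
  then show ?thesis by (auto simp: n_def eval_nat_numeral)
qed

lemma local_dim_of_chain:
  fixes x :: "'k::alg_closed_field ^ ('r::finite \<times> 3 \<times> 3)"
  assumes "closed_chain (zar commuting_nilpotent) (4 + 2 * CARD('r)) Z" "x \<in> Z 0"
  shows "local_dim commuting_nilpotent x = enat (4 + 2 * CARD('r))"
  unfolding local_dim_altdef
proof (rule antisym)
  show "Sup {enat n |n. \<exists>C. x \<in> C 0 \<and> closed_chain (zar commuting_nilpotent) n C} \<le> enat (4 + 2 * CARD('r))"
    using commuting_nilpotent_chain_le by (intro Sup_least) auto
  show "enat (4 + 2 * CARD('r)) \<le> Sup {enat n |n. \<exists>C. x \<in> C 0 \<and> closed_chain (zar commuting_nilpotent) n C}"
    using assms by (intro Sup_upper) blast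
qed

section \<open>Tangent spaces at regular tuples\<close>

definition mpolyvel :: "('k::comm_ring_1 \<Rightarrow> 'k ^ 3 ^ 3) \<Rightarrow> 'k ^ 3 ^ 3 \<Rightarrow> bool" where
  "mpolyvel A A' \<longleftrightarrow> (\<forall>i j. polyvel (\<lambda>t. A t $ i $ j) (A' $ i $ j))"

lemma mpolyvel_mult:
  assumes "mpolyvel A A'" "mpolyvel B B'"
  shows "mpolyvel (\<lambda>t. A t ** B t) (A 0 ** B' + A' ** B 0)"
  unfolding mpolyvel_def
proof (intro allI)
  fix i j
  have "polyvel (\<lambda>t. \<Sum>l\<in>UNIV. A t $ i $ l * B t $ l $ j) (\<Sum>l\<in>UNIV. A 0 $ i $ l * B' $ l $ j + A' $ i $ l * B 0 $ l $ j)"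
    using assms unfolding mpolyvel_def by (intro polyvel_sum polyvel_mult) auto
  then show "polyvel (\<lambda>t. (A t ** B t) $ i $ j) ((A 0 ** B' + A' ** B 0) $ i $ j)"
    by (simp add: matrix_matrix_mult_def sum.distrib)
qed

lemma mpolyvel_diff: "mpolyvel A A' \<Longrightarrow> mpolyvel B B' \<Longrightarrow> mpolyvel (\<lambda>t. A t - B t) (A' - B')"
  unfolding mpolyvel_def by (simp add: polyvel_diff)

lemma mpolyvel_mats_line: "mpolyvel (\<lambda>t. mats (x + t *s w) i) (mats w i)"
  unfolding mpolyvel_def mats_nth by (intro allI polyvel_line)

lemma mats_line_0: "mats (x + 0 *s w) i = mats x i" for x :: "'k::comm_ring_1 ^ _"
  by (simp add: vec_eq_iff mats_nth)

lemma tangent_commuting_nilpotent: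
  fixes x :: "'k::alg_closed_field ^ ('r::finite \<times> 3 \<times> 3)"
  assumes "w \<in> tangent_space commuting_nilpotent x"
  shows "mats x i ** mats w j + mats w i ** mats x j = mats x j ** mats w i + mats w j ** mats x i"
    and "mats x i ** mats x j ** mats w l + (mats x i ** mats w j + mats w i ** mats x j) ** mats x l = 0"
proof -
  have entry: "polyfun (\<lambda>v :: 'k ^ ('r \<times> 3 \<times> 3). mats v i $ a $ b)" for i a b
    unfolding mats_nth by (rule polyfun_coord)
  have "(mats x i ** mats w j + mats w i ** mats x j - (mats x j ** mats w i + mats w j ** mats x i)) $ a $ b = 0"
    for a b
  proof (rule tangent_space_polyvel[OF assms, where h = "\<lambda>v. (mats v i ** mats v j - mats v j ** mats v i) $ a $ b"])
    show "polyfun (\<lambda>v :: 'k ^ ('r \<times> 3 \<times> 3). (mats v i ** mats v j - mats v j ** mats v i) $ a $ b)"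
      unfolding vector_minus_component matrix_mult_33_nth
      by (intro polyfun_diff polyfun_add polyfun_mult entry)
    show "polyvel (\<lambda>t. (mats (x + t *s w) i ** mats (x + t *s w) j - mats (x + t *s w) j ** mats (x + t *s w) i) $ a $ b)
      ((mats x i ** mats w j + mats w i ** mats x j - (mats x j ** mats w i + mats w j ** mats x i)) $ a $ b)"
      using mpolyvel_diff[OF mpolyvel_mult[OF mpolyvel_mats_line[of x w i] mpolyvel_mats_line[of x w j]]
          mpolyvel_mult[OF mpolyvel_mats_line[of x w j] mpolyvel_mats_line[of x w i]]]
      unfolding mats_line_0 mpolyvel_def by blast
  qed (simp add: commuting_nilpotentD(1)[of _ i j])
  then show "mats x i ** mats w j + mats w i ** mats x j = mats x j ** mats w i + mats w j ** mats x i"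
    by (simp add: vec_eq_iff)
  have "(mats x i ** mats x j ** mats w l + (mats x i ** mats w j + mats w i ** mats x j) ** mats x l) $ a $ b = 0"
    for a b
  proof (rule tangent_space_polyvel[OF assms, where h = "\<lambda>v. (mats v i ** mats v j ** mats v l) $ a $ b"])
    show "polyfun (\<lambda>v :: 'k ^ ('r \<times> 3 \<times> 3). (mats v i ** mats v j ** mats v l) $ a $ b)"
      unfolding matrix_mult_33_nth by (intro polyfun_add polyfun_mult entry)
    show "polyvel (\<lambda>t. (mats (x + t *s w) i ** mats (x + t *s w) j ** mats (x + t *s w) l) $ a $ b)
      ((mats x i ** mats x j ** mats w l + (mats x i ** mats w j + mats w i ** mats x j) ** mats x l) $ a $ b)"
      using mpolyvel_mult[OF mpolyvel_mult[OF mpolyvel_mats_line[of x w i] mpolyvel_mats_line[of x w j]]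
          mpolyvel_mats_line[of x w l]]
      unfolding mats_line_0 mpolyvel_def by blast
  qed (simp add: commuting_nilpotent_triple)
  then show "mats x i ** mats x j ** mats w l + (mats x i ** mats w j + mats w i ** mats x j) ** mats x l = 0"
    by (simp add: vec_eq_iff)
qed

text \<open>
  These entries restrict to linear coordinates on the tangent space at every tuple of polynomials
  in the Jordan block whose component \<open>i0\<close> is regular.
\<close>

definition tangent_coords :: "'r \<Rightarrow> 'k::zero ^ ('r::finite \<times> 3 \<times> 3) \<Rightarrow> 'k ^ (4 + 'r + 'r)" where
  "tangent_coords i0 w = (\<chi> q. case q of
     Inl j \<Rightarrow> (if j = 1 then w $ (i0, 1, 1) else if j = 2 then w $ (i0, 3, 3)
               else if j = 3 then w $ (i0, 3, 2) else w $ (i0, 2, 3))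
   | Inr (Inl i) \<Rightarrow> w $ (i, 1, 2) | Inr (Inr i) \<Rightarrow> w $ (i, 1, 3))"

lemma tangent_coords_nth:
  "tangent_coords i0 w $ Inl 1 = w $ (i0, 1, 1)" "tangent_coords i0 w $ Inl 2 = w $ (i0, 3, 3)"
  "tangent_coords i0 w $ Inl 3 = w $ (i0, 3, 2)" "tangent_coords i0 w $ Inl 4 = w $ (i0, 2, 3)"
  "tangent_coords i0 w $ Inr (Inl i) = w $ (i, 1, 2)" "tangent_coords i0 w $ Inr (Inr i) = w $ (i, 1, 3)"
  by (simp_all add: tangent_coords_def)

lemma tangent_coords_eq_iff:
  "tangent_coords i0 w = y \<longleftrightarrow> w $ (i0, 1, 1) = y $ Inl 1 \<and> w $ (i0, 3, 3) = y $ Inl 2 \<and>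
    w $ (i0, 3, 2) = y $ Inl 3 \<and> w $ (i0, 2, 3) = y $ Inl 4 \<and>
    (\<forall>i. w $ (i, 1, 2) = y $ Inr (Inl i)) \<and> (\<forall>i. w $ (i, 1, 3) = y $ Inr (Inr i))"
proof -
  have all: "(\<forall>q. P q) \<longleftrightarrow> (\<forall>j. P (Inl j)) \<and> (\<forall>i. P (Inr (Inl i))) \<and> (\<forall>i. P (Inr (Inr i)))"
    for P :: "4 + 'b + 'b \<Rightarrow> bool"
    by (metis sum.exhaust)
  show ?thesis
    unfolding vec_eq_iff all forall_4 by (simp add: tangent_coords_nth)
qed

lemma linear_tangent_coords:
  "Vector_Spaces.linear (*s) (*s) (tangent_coords i0 :: 'k::field ^ ('r::finite \<times> 3 \<times> 3) \<Rightarrow> _)"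
  by unfold_locales (simp_all add: tangent_coords_eq_iff tangent_coords_nth)

abbreviation standard_tuple :: "('r::finite \<Rightarrow> 'k::comm_ring_1) \<Rightarrow> ('r \<Rightarrow> 'k) \<Rightarrow> 'k ^ ('r \<times> 3 \<times> 3)" where
  "standard_tuple \<equiv> flagged (mat 1) 1 1"

lemma mats_standard_tuple: "mats (standard_tuple a b) i = strict_upper (a i) (a i) (b i)"
  by (simp add: flagged_def)

lemma tangent_coords_injective:
  fixes a b :: "'r::finite \<Rightarrow> 'k::alg_closed_field"
  assumes "w \<in> tangent_space commuting_nilpotent (standard_tuple a b)" "a i0 = 1"
    "tangent_coords i0 w = 0"
  shows "w = 0"
proof -
  note T = tangent_commuting_nilpotent[OF assms(1), unfolded mats_standard_tuple]
  have w: "mats w i0 $ 1 $ 1 = 0" "mats w i0 $ 3 $ 3 = 0" "mats w i0 $ 3 $ 2 = 0" "mats w i0 $ 2 $ 3 = 0"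
    and wi: "\<And>i. mats w i $ 1 $ 2 = 0" "\<And>i. mats w i $ 1 $ 3 = 0"
    using assms(3) unfolding tangent_coords_eq_iff mats_nth by simp_all
  \<comment> \<open>The linearized cube of the regular component determines the entries that the
    coordinates leave open: (3,1), (2,1) and (2,2).\<close>
  have i0: "mats w i0 = 0"
    using T(2)[of i0 i0 i0] w wi[of i0] assms(2)
    by (auto simp: m33_simps strict_upper_def)
  \<comment> \<open>With component \<open>i0\<close> at rest, commutation makes the others
    polynomials in the Jordan block. The triple products remove the constant term, and the other two
    coefficients are the entries (1,2) and (1,3).\<close>
  have "mats w i = 0" for i
    using T(1)[of i i0] T(2)[of i i0 i0] wi[of i] assms(2) T(2)[of i0 i0 i] unfolding i0
    by (auto simp: m33_simps strict_upper_def)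
  then show ?thesis by (intro mats_eqI) (simp add: vec_eq_iff mats_nth)
qed

lemma tangent_coords_surjective:
  fixes a b :: "'r::finite \<Rightarrow> 'k::alg_closed_field"
  assumes "a i0 = 1"
  shows "\<exists>w \<in> tangent_space commuting_nilpotent (standard_tuple a b). tangent_coords i0 w = y"
proof -
  \<comment> \<open>Here \<open>e1\<close>, \<open>e2\<close>, \<open>e3\<close> are velocities of
    the flag, \<open>d\<close> of the parameter \<open>t\<close>, and \<open>a'\<close>,
    \<open>b'\<close> of the coefficients. The coordinates of the resulting velocity depend on them
    in a triangular way, so they are solved for in this order.\<close>
  define e2 where "e2 = y $ Inl 3"
  define e1 where "e1 = - y $ Inl 1 - b i0 * e2"
  define e3 where "e3 = y $ Inl 2 - b i0 * e2"
  define a' where "a' = (\<lambda>i. y $ Inr (Inl i) + b i * e3)"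
  define b' where "b' = (\<lambda>i. y $ Inr (Inr i))"
  define d where "d = y $ Inl 4 - a' i0 - b i0 * e1"
  define H where "H = (\<lambda>t. lower_unitriangular (t * e1) (t * e2) (t * e3))"
  define n where "n = mat33 0 0 0 e1 0 0 e2 e3 0"
  define S where "S = (\<lambda>i t. strict_upper (a i + t * a' i) ((a i + t * a' i) * (1 + t * d)) (b i + t * b' i))"
  define S' where "S' = (\<lambda>i. strict_upper (a' i) (a i * d + a' i) (b' i))"
  define c where "c = (\<lambda>t. flagged (H t) 1 (1 + t * d) (\<lambda>i. a i + t * a' i) (\<lambda>i. b i + t * b' i))"
  have lin: "polyvel (\<lambda>t. u + t * v) v" for u v :: 'k
    using polyvel_add[OF polyvel_const[of u] polyvel_mult[OF polyvel_id polyvel_const[of v]]] by simp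
  have lin0: "polyvel (\<lambda>t. t * v) v" for v :: 'k
    using lin[of 0] by simp
  have H: "mpolyvel H n"
    unfolding mpolyvel_def forall_3
    by (simp add: H_def n_def lower_unitriangular_def polyvel_const lin0)
  have adjH: "adj3 (H t) = mat33 1 0 0 (- (t * e1)) 1 0 (t * e1 * (t * e3) - t * e2) (- (t * e3)) 1" for t
    by (simp add: H_def adj3_def lower_unitriangular_def)
  have sq: "polyvel (\<lambda>t. t * e1 * (t * e3) - t * e2) (- e2)"
    using polyvel_diff[OF polyvel_mult[OF lin0[of e1] lin0[of e3]] lin0[of e2]] by simp
  \<comment> \<open>The adjugate of a unitriangular matrix is its inverse, which at the identity has
    the opposite velocity.\<close>
  have adj: "mpolyvel (\<lambda>t. adj3 (H t)) (- n)"
    unfolding mpolyvel_def forall_3 adjH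
    by (simp add: n_def polyvel_const polyvel_uminus[OF lin0] sq)
  have S: "mpolyvel (S i) (S' i)" for i
    unfolding mpolyvel_def forall_3
    using polyvel_mult[OF lin[of "a i" "a' i"] lin[of 1 d]]
    by (simp add: S_def S'_def strict_upper_def polyvel_const lin)
  have c: "mats (c t) i = H t ** S i t ** adj3 (H t)" for t i
    by (simp add: c_def S_def flagged_def)
  have H0: "H 0 = mat 1" "S i 0 = strict_upper (a i) (a i) (b i)" for i
    by (simp_all add: H_def S_def lower_unitriangular_def m33_simps)
  define w where "w = tup (\<lambda>i. strict_upper (a i) (a i) (b i) ** (- n) + (S' i + n ** strict_upper (a i) (a i) (b i)))"
  have vel: "mpolyvel (\<lambda>t. mats (c t) i) (mats w i)" for i
    using mpolyvel_mult[OF mpolyvel_mult[OF H S[of i]] adj] unfolding c H0 by (simp add: w_def)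
  have "w \<in> tangent_space commuting_nilpotent (c 0)"
  proof (rule tangent_space_of_curve)
    show "polyvel (\<lambda>t. c t $ p) (w $ p)" for p
      using vel[of "fst p"] unfolding mpolyvel_def mats_nth by (metis prod.collapse)
    show "c t \<in> commuting_nilpotent" for t
      unfolding c_def by (rule flagged_in_commuting_nilpotent)
  qed
  moreover have "c 0 = standard_tuple a b"
    by (simp add: c_def H0)
  moreover have "tangent_coords i0 w = y"
    unfolding tangent_coords_eq_iff
    by (simp add: w_def tup_nth n_def strict_upper_def S'_def matrix_mult_33_nth assms)
      (simp add: e1_def e3_def e2_def a'_def b'_def d_def algebra_simps)
  ultimately show ?thesis by auto
qed

lemma dim_tangent_space_standard_tuple:
  fixes a b :: "'r::finite \<Rightarrow> 'k::alg_closed_field"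
  assumes "a i0 = 1"
  shows "vec.dim (tangent_space commuting_nilpotent (standard_tuple a b)) = 4 + 2 * CARD('r)"
proof -
  let ?T = "tangent_space commuting_nilpotent (standard_tuple a b)"
  have sub: "vec.subspace ?T" by (rule subspace_tangent_space)
  have "inj_on (tangent_coords i0) ?T"
  proof (rule inj_onI)
    fix w w' assume w: "w \<in> ?T" "w' \<in> ?T" "tangent_coords i0 w = tangent_coords i0 w'"
    have "w - w' \<in> ?T" using w sub by (simp add: vec.subspace_diff)
    moreover have "tangent_coords i0 (w - w') = 0"
      using w(3) by (simp add: vec.linear_diff[OF linear_tangent_coords])
    ultimately have "w - w' = 0" using tangent_coords_injective[of _ a b i0] assms by blast
    then show "w = w'" by simp
  qed
  then have "vec.dim (tangent_coords i0 ` ?T) = vec.dim ?T"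
    using sub by (intro vec.dim_image_eq linear_tangent_coords) (simp add: vec.span_eq_iff[THEN iffD2])
  moreover have "tangent_coords i0 ` ?T = UNIV"
  proof (intro equalityI subsetI)
    fix y
    obtain w where "w \<in> ?T" "tangent_coords i0 w = y"
      using tangent_coords_surjective[where a = a and b = b and y = y, OF assms] by (elim bexE)
    then show "y \<in> tangent_coords i0 ` ?T" by (intro image_eqI) auto
  qed simp
  ultimately show ?thesis by (simp add: card_cart_basis)
qed

section \<open>Conjugation and transposition of tuples\<close>

lemma conj_linear_symmetry:
  fixes G :: "'k::field ^ 3 ^ 3"
  assumes "G ** G' = mat 1" "G' ** G = mat 1"
  shows "linear_symmetry commuting_nilpotent (\<lambda>v :: 'k ^ ('r::finite \<times> 3 \<times> 3). tup (\<lambda>i. G ** mats v i ** G'))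
    (\<lambda>v. tup (\<lambda>i. G' ** mats v i ** G))"
proof -
  have lin: "Vector_Spaces.linear (*s) (*s) (\<lambda>v :: 'k ^ ('r \<times> 3 \<times> 3). tup (\<lambda>i. A ** mats v i ** B))"
    for A B :: "'k ^ 3 ^ 3"
    by unfold_locales (simp_all add: vec_eq_iff split_paired_all tup_nth mats_nth matrix_mult_33_nth algebra_simps)
  have stable: "tup (\<lambda>i. A ** mats v i ** B) \<in> commuting_nilpotent"
    if "A ** B = mat 1" "B ** A = mat 1" and v: "v \<in> commuting_nilpotent"
    for A B and v :: "'k ^ ('r \<times> 3 \<times> 3)"
  proof (rule commuting_nilpotentI)
    have mult: "(A ** X ** B) ** (A ** Y ** B) = A ** (X ** Y) ** B" for X Y
    proof -
      have "(A ** X ** B) ** (A ** Y ** B) = A ** X ** (B ** A) ** Y ** B"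
        by (simp add: matrix_mul_assoc)
      then show ?thesis by (simp add: that(2) matrix_mul_assoc)
    qed
    note D = commuting_nilpotentD[OF v]
    show "mats (tup (\<lambda>i. A ** mats v i ** B)) i ** mats (tup (\<lambda>i. A ** mats v i ** B)) j =
      mats (tup (\<lambda>i. A ** mats v i ** B)) j ** mats (tup (\<lambda>i. A ** mats v i ** B)) i" for i j
      by (simp add: mult D(1)[of i j])
    show "mats (tup (\<lambda>i. A ** mats v i ** B)) i ** mats (tup (\<lambda>i. A ** mats v i ** B)) i **
      mats (tup (\<lambda>i. A ** mats v i ** B)) i = 0" for i
      by (simp add: mult D(3))
    fix i
    have "trace (A ** (mats v i ** B)) = trace (mats v i ** B ** A)" by (rule trace_mul_sym)
    also have "mats v i ** B ** A = mats v i" by (simp add: that(2) flip: matrix_mul_assoc)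
    finally show "trace (mats (tup (\<lambda>i. A ** mats v i ** B)) i) = 0"
      using D(2) by (simp add: matrix_mul_assoc)
  qed
  have "tup (\<lambda>i. A ** mats (tup (\<lambda>i. B ** mats v i ** A)) i ** B) = v"
    if "A ** B = mat 1" for A B and v :: "'k ^ ('r \<times> 3 \<times> 3)"
    by (rule mats_eqI) (simp add: conjugate_of_mult[OF that])
  then show ?thesis
    unfolding linear_symmetry_def using lin stable assms by blast
qed

lemma transpose_linear_symmetry:
  "linear_symmetry commuting_nilpotent (\<lambda>v :: 'k::field ^ ('r::finite \<times> 3 \<times> 3). tup (\<lambda>i. transpose (mats v i)))
    (\<lambda>v. tup (\<lambda>i. transpose (mats v i)))"
proof -
  have "Vector_Spaces.linear (*s) (*s) (\<lambda>v :: 'k ^ ('r \<times> 3 \<times> 3). tup (\<lambda>i. transpose (mats v i)))"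
    by unfold_locales (simp_all add: vec_eq_iff split_paired_all tup_nth mats_nth transpose_def)
  moreover have "tup (\<lambda>i. transpose (mats v i)) \<in> commuting_nilpotent"
    if v: "v \<in> commuting_nilpotent" for v :: "'k ^ ('r \<times> 3 \<times> 3)"
  proof (rule commuting_nilpotentI)
    note D = commuting_nilpotentD[OF v]
    show "mats (tup (\<lambda>i. transpose (mats v i))) i ** mats (tup (\<lambda>i. transpose (mats v i))) j =
      mats (tup (\<lambda>i. transpose (mats v i))) j ** mats (tup (\<lambda>i. transpose (mats v i))) i" for i j
      using D(1)[of i j] by (simp flip: matrix_transpose_mul)
    show "trace (mats (tup (\<lambda>i. transpose (mats v i))) i) = 0" for i
      using D(2)[of i] by (simp add: trace_33 transpose_def)
    have "transpose (mats v i ** (mats v i ** mats v i)) = 0" for i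
      using D(3)[of i] by (simp add: matrix_mul_assoc transpose_def vec_eq_iff)
    then show "mats (tup (\<lambda>i. transpose (mats v i))) i ** mats (tup (\<lambda>i. transpose (mats v i))) i **
      mats (tup (\<lambda>i. transpose (mats v i))) i = 0" for i
      by (simp add: matrix_transpose_mul)
  qed
  moreover have "tup (\<lambda>i. transpose (mats (tup (\<lambda>i. transpose (mats v i))) i)) = v"
    for v :: "'k ^ ('r \<times> 3 \<times> 3)"
    by simp
  ultimately show ?thesis unfolding linear_symmetry_def by blast
qed

lemma regular_not_singular:
  fixes v :: "'k::alg_closed_field ^ ('r::finite \<times> 3 \<times> 3)"
  assumes "v \<in> commuting_nilpotent" "mats v i0 ** mats v i0 \<noteq> 0"
  shows "v \<notin> singular_locus commuting_nilpotent"
proof -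
  obtain G G' a b where G: "G ** G' = mat 1" "G' ** G = mat 1"
    "\<And>i. G' ** mats v i ** G = strict_upper (a i) (a i) (b i)" and a: "a i0 = 1"
    using regular_tuple_conjugate[OF assms] by metis
  let ?g = "\<lambda>v :: 'k ^ ('r \<times> 3 \<times> 3). tup (\<lambda>i. G ** mats v i ** G')"
  note sym = conj_linear_symmetry[OF G(1,2), where 'r = 'r]
  have v: "v = ?g (standard_tuple a b)"
  proof (rule mats_eqI)
    show "mats v i = mats (?g (standard_tuple a b)) i" for i
      using conjugate_of_mult[OF G(1), of "mats v i"] by (simp add: mats_standard_tuple G(3))
  qed
  obtain Z where Z: "closed_chain (zar commuting_nilpotent) (4 + 2 * CARD('r)) Z" "standard_tuple a b \<in> Z 0"
    using standard_chain by blast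
  have "v \<in> ?g ` Z 0" using Z(2) unfolding v by (rule imageI)
  then have "local_dim commuting_nilpotent v = enat (4 + 2 * CARD('r))"
    using local_dim_of_chain[OF linear_symmetry_image_chain[OF sym Z(1)]] by simp
  moreover have "vec.dim (tangent_space commuting_nilpotent v) = 4 + 2 * CARD('r)"
    unfolding v linear_symmetry_dim_tangent_space[OF sym] by (rule dim_tangent_space_standard_tuple[of a i0 b, OF a])
  ultimately show ?thesis by (simp add: singular_locus_def)
qed

definition square_zero_tuples :: "('k::field ^ ('r::finite \<times> 3 \<times> 3)) set" where
  "square_zero_tuples = {v \<in> commuting_nilpotent. \<forall>i. mats v i ** mats v i = 0}"

lemma singular_locus_subset_square_zero:
  "singular_locus (commuting_nilpotent :: ('k::alg_closed_field ^ ('r::finite \<times> 3 \<times> 3)) set) \<subseteq> square_zero_tuples"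
proof
  fix v :: "'k ^ ('r \<times> 3 \<times> 3)"
  assume v: "v \<in> singular_locus commuting_nilpotent"
  then have "v \<in> commuting_nilpotent" by (simp add: singular_locus_def)
  then show "v \<in> square_zero_tuples"
    using regular_not_singular v unfolding square_zero_tuples_def by blast
qed

section \<open>The closure of the subregular orbit\<close>

lemma rank_outer:
  fixes u w :: "'k::field ^ 3"
  assumes "outer u w \<noteq> 0"
  shows "rank (outer u w) = 1"
proof -
  have rows: "row i (outer u w) = u $ i *s w" for i
    by (simp add: row_def vec_eq_iff)
  have "rows (outer u w) \<subseteq> vec.span {w}"
    by (auto simp: rows_def rows intro!: vec.span_scale[OF vec.span_base])
  then have "vec.dim (rows (outer u w)) \<le> card {w}"
    by (rule vec.dim_le_card) simp
  then have "vec.dim (rows (outer u w)) \<le> 1" by simp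
  moreover have "vec.dim (rows (outer u w)) \<noteq> 0"
  proof
    assume "vec.dim (rows (outer u w)) = 0"
    then have "rows (outer u w) \<subseteq> {0}" by simp
    then have "row i (outer u w) = 0" for i unfolding rows_def by auto
    then show False using assms by (simp add: row_def vec_eq_iff)
  qed
  ultimately have "vec.dim (rows (outer u w)) = 1" by linarith
  then show ?thesis unfolding row_rank_def_gen .
qed

lemma nilpotent_matrix_of_square: "A ** A = 0 \<Longrightarrow> nilpotent_matrix A" for A :: "'k::field ^ 3 ^ 3"
  by (rule nilpotent_matrix_of_cube) (simp add: m33_simps)

text \<open>A nonzero square-zero matrix of trace zero has rank one and lies in the orbit itself.
  Only the zero matrix requires a limit, along the multiples of one matrix unit.\<close>

lemma square_zero_in_subregular_closure:
  fixes x :: "'k::alg_closed_field ^ (3 \<times> 3)"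
  assumes "trace (to_matrix x) = 0" "to_matrix x ** to_matrix x = 0"
  shows "x \<in> subregular_closure"
proof -
  have orbit: "z \<in> subregular_orbit"
    if z: "trace (to_matrix z) = 0" "to_matrix z ** to_matrix z = 0" "to_matrix z \<noteq> 0" for z :: "'k ^ (3 \<times> 3)"
  proof -
    have cone: "z \<in> nilpotent_cone"
      using z nilpotent_matrix_of_square by (simp add: nilpotent_cone_def sl3_def)
    obtain u w where uw: "to_matrix z = outer u w" using square_zero_outer[OF z(2,1,3)] by blast
    have "rank (to_matrix z) = 1" unfolding uw by (rule rank_outer) (use z(3) uw in simp)
    then show "z \<in> subregular_orbit" using cone by (simp add: subregular_orbit_def)
  qed
  have closure: "subregular_orbit \<subseteq> (subregular_closure :: ('k ^ (3 \<times> 3)) set)"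
    unfolding subregular_closure_def by (rule closure_of_subset) (simp add: subregular_orbit_def)
  show ?thesis
  proof (cases "to_matrix x = 0")
    case False
    then show ?thesis using orbit[OF assms] closure by blast
  next
    case True
    have "x $ (i, j) = to_matrix x $ i $ j" for i j by (simp add: to_matrix_def)
    then have "x $ (i, j) = 0" for i j using True by simp
    then have x: "x = 0" by (simp add: vec_eq_iff split_paired_all)
    define c :: "'k \<Rightarrow> 'k ^ (3 \<times> 3)" where "c = (\<lambda>t. \<chi> p. if p = (1, 3) then t else 0)"
    have mc: "to_matrix (c t) = strict_upper 0 0 t" for t
      by (simp add: mat33_eq_iff to_matrix_def c_def strict_upper_def)
    have c: "polycurve c"
      unfolding polycurve_def
    proof
      show "poly1 (\<lambda>t. c t $ p)" for p
        by (cases "p = (1, 3)") (simp_all add: c_def poly1_intros)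
    qed
    have c0: "c 0 = 0" by (simp add: c_def vec_eq_iff)
    have ct: "c t \<in> subregular_closure" if "t \<noteq> 0" for t
    proof (rule subsetD[OF closure orbit])
      show "to_matrix (c t) \<noteq> 0" unfolding mc using that by (simp add: mat33_eq_iff strict_upper_def)
    qed (simp_all add: mc strict_upper_mult, simp_all add: strict_upper_def m33_simps)
    have x_cone: "x \<in> nilpotent_cone"
      using assms nilpotent_matrix_of_square by (simp add: nilpotent_cone_def sl3_def)
    show ?thesis
    proof (rule ccontr)
      assume "x \<notin> subregular_closure"
      then obtain h where h: "polyfun h" "\<And>z. z \<in> subregular_closure \<Longrightarrow> h z = 0" "h x \<noteq> 0"
        using closed_separating_polyfun[of nilpotent_cone subregular_closure x] x_cone
        unfolding subregular_closure_def by (metis closedin_closure_of)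
      \<comment> \<open>The factor \<open>t\<close> takes care of the parameter 0, the only one at
        which the curve leaves the orbit.\<close>
      have "h (c t) * t = 0" for t using h(2) ct by (cases "t = 0") auto
      then have "h (c 0) = 0"
        using poly1_cover[OF polycurve_polyfun[OF c h(1)] poly1_id, of 1] by simp
      then show False using h(3) by (simp add: c0 x)
    qed
  qed
qed

lemma square_zero_tuples_subset:
  "(square_zero_tuples :: ('k::alg_closed_field ^ ('r::finite \<times> 3 \<times> 3)) set) \<subseteq>
    commuting_variety subregular_closure"
proof
  fix v :: "'k ^ ('r \<times> 3 \<times> 3)"
  assume v: "v \<in> square_zero_tuples"
  then have "v \<in> commuting_nilpotent" by (simp add: square_zero_tuples_def)
  note D = commuting_nilpotentD[OF this]
  have "component v i \<in> subregular_closure" for i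
    by (rule square_zero_in_subregular_closure)
      (use v D(2)[of i] in \<open>auto simp: square_zero_tuples_def simp flip: mats_def\<close>)
  then show "v \<in> commuting_variety subregular_closure"
    using D(1) by (simp add: commuting_variety_def mats_def)
qed

section \<open>The codimension\<close>

lemma matrix_add_rdistrib: "(A + B) ** C = A ** C + B ** C" for C :: "'k::semiring_1 ^ 'n ^ 'm"
  by (simp add: vec_eq_iff matrix_matrix_mult_def distrib_right sum.distrib)

lemma outer_mult: "outer u w ** outer u' w' = outer (dot w u' *s u) w'"
  for u :: "'k::comm_semiring_1 ^ 3"
  by (simp add: vec_eq_iff outer_mult_nth mult_ac)

abbreviation e3 :: "'k::comm_ring_1 ^ 3" where
  "e3 \<equiv> vector [0, 0, 1]"

text \<open>
  A family of dimension one more than that of \<open>common_image\<close>, which is its member \<open>t = 0\<close>: flags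
  whose plane contains the third basis vector.
\<close>

definition bent_tuple :: "'k::comm_ring_1 ^ 3 \<Rightarrow> ('r \<Rightarrow> 'k ^ 3) \<Rightarrow> 'k \<Rightarrow> 'k ^ ('r::finite \<times> 3 \<times> 3)" where
  "bent_tuple u z t = tup (\<lambda>i. outer u (cross u (z i)) +
     outer e3 ((t * dot (cross u (z i)) e3) *s cross u e3))"

lemma dot_cross [simp]: "dot (cross u w) u = 0" "dot (cross u w) w = 0" "dot u (cross u w) = 0" "dot w (cross u w) = 0"
  by (simp_all add: dot_def algebra_simps)

lemma dot_scale_left: "dot (c *s u) w = c * dot u w"
  by (simp add: dot_def algebra_simps)

lemma outer_zero_left: "outer 0 w = 0"
  by (simp add: vec_eq_iff)

text \<open>Since \<open>cross u e3\<close> is orthogonal to \<open>u\<close> and \<open>e3\<close>,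
  and \<open>cross u (z i)\<close> to \<open>u\<close>, only one of the four terms of the product
  survives. It is symmetric in \<open>i\<close> and \<open>j\<close> and carries the factor
  \<open>t\<close>.\<close>

lemma bent_tuple_mult:
  "mats (bent_tuple u z t) i ** mats (bent_tuple u z t) j =
    outer ((t * dot (cross u (z i)) e3 * dot (cross u (z j)) e3) *s u) (cross u e3)"
proof -
  have "mats (bent_tuple u z t) i ** mats (bent_tuple u z t) j =
    outer (dot (cross u (z i)) e3 *s u) ((t * dot (cross u (z j)) e3) *s cross u e3)"
    by (simp add: bent_tuple_def matrix_add_ldistrib matrix_add_rdistrib outer_mult dot_scale_left outer_zero_left)
  then show ?thesis by (simp add: vec_eq_iff mult_ac)
qed

lemma bent_tuple_in_commuting_nilpotent: "bent_tuple u z t \<in> commuting_nilpotent"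
proof (rule commuting_nilpotentI)
  show "mats (bent_tuple u z t) i ** mats (bent_tuple u z t) j = mats (bent_tuple u z t) j ** mats (bent_tuple u z t) i" for i j
    by (simp add: bent_tuple_mult mult_ac)
  show "trace (mats (bent_tuple u z t) i) = 0" for i
    by (simp add: bent_tuple_def trace_add trace_outer dot_scale)
  show "mats (bent_tuple u z t) i ** mats (bent_tuple u z t) i ** mats (bent_tuple u z t) i = 0" for i
    unfolding bent_tuple_mult
    by (simp add: bent_tuple_def matrix_add_ldistrib outer_mult outer_zero_left)
qed

definition bent_set :: "('k::comm_ring_1 ^ ('r::finite \<times> 3 \<times> 3)) set" where
  "bent_set = {bent_tuple u z t |u z t. True}"

lemma common_image_subset_bent_set:
  "(common_image :: ('k::field ^ ('r::finite \<times> 3 \<times> 3)) set) \<subseteq> bent_set"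
proof
  fix v :: "'k ^ ('r \<times> 3 \<times> 3)"
  assume "v \<in> common_image"
  then obtain u w where uw: "\<And>i. mats v i = outer u (w i)" "\<And>i. dot u (w i) = 0"
    unfolding common_image_def by blast
  have "\<exists>z. outer u (w i) = outer u (cross u z)" for i
  proof (cases "u = 0")
    case False
    then show ?thesis using orthogonal_imp_cross[OF uw(2)[of i]] by metis
  qed (simp add: outer_zero_left)
  then obtain z where z: "\<And>i. outer u (w i) = outer u (cross u (z i))" by metis
  have "v = bent_tuple u z 0"
    by (rule mats_eqI) (simp add: uw(1) z bent_tuple_def vec_eq_iff)
  then show "v \<in> bent_set" unfolding bent_set_def by blast
qed

text \<open>The cross products leave no condition on \<open>u\<close>, \<open>z\<close> and
  \<open>t\<close>, so segments of parameters stay in the family.\<close>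

lemma poly_connected_bent_set: "poly_connected (bent_set :: ('k::field ^ ('r::finite \<times> 3 \<times> 3)) set)"
  unfolding poly_connected_def
proof (intro conjI ballI)
  show "(bent_set :: ('k ^ ('r \<times> 3 \<times> 3)) set) \<noteq> {}" unfolding bent_set_def by blast
  fix v v' :: "'k ^ ('r \<times> 3 \<times> 3)"
  assume "v \<in> bent_set" "v' \<in> bent_set"
  then obtain u z t u' z' t' where *: "v = bent_tuple u z t" "v' = bent_tuple u' z' t'"
    unfolding bent_set_def by blast
  define c :: "'k \<Rightarrow> 'k ^ ('r \<times> 3 \<times> 3)" where "c = (\<lambda>l. bent_tuple (\<chi> i. segment (u $ i) (u' $ i) l)
    (\<lambda>i. \<chi> j. segment (z i $ j) (z' i $ j) l) (segment t t' l))"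
  have "poly1 (\<lambda>l. c l $ (i, a, b))" for i a b
    using exhaust_3[of a] exhaust_3[of b]
    by (elim disjE) (simp_all add: c_def bent_tuple_def tup_nth dot_def, (intro poly1_intros)+)
  then have "polycurve c" unfolding polycurve_def by (simp add: split_paired_all)
  moreover have "range c \<subseteq> bent_set" unfolding c_def bent_set_def by blast
  moreover have "c 0 = v" "c 1 = v'" by (simp_all add: c_def * vec_lambda_eta)
  ultimately show "\<exists>c. polycurve c \<and> range c \<subseteq> bent_set \<and> c 0 = v \<and> c 1 = v'" by blast
qed

lemma polyfun_mats_square: "polyfun (\<lambda>v :: 'k::comm_ring_1 ^ ('r::finite \<times> 3 \<times> 3). (mats v i ** mats v i) $ a $ b)"
  unfolding matrix_mult_33_nth mats_nth by (intro polyfun_add polyfun_mult polyfun_coord)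

abbreviation bent_closure :: "('k::field ^ ('r::finite \<times> 3 \<times> 3)) set" where
  "bent_closure \<equiv> zar commuting_nilpotent closure_of bent_set"

lemma bent_set_subset: "bent_set \<subseteq> commuting_nilpotent"
  unfolding bent_set_def using bent_tuple_in_commuting_nilpotent by blast

lemma bent_closure_psubset:
  "(bent_closure :: ('k::alg_closed_field ^ ('r::finite \<times> 3 \<times> 3)) set) \<subset> commuting_nilpotent"
proof -
  obtain i0 :: 'r where True by simp
  have "bent_closure \<subset> zar commuting_nilpotent closure_of (commuting_nilpotent :: ('k ^ ('r \<times> 3 \<times> 3)) set)"
  \<comment> \<open>The rows of a square in the bent family are multiples of
    \<open>cross u e3\<close>, whose third coordinate is zero, whereas the square of a Jordan block
    has entry (1,3) equal to 1.\<close>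
  proof (rule closure_of_psubset[OF bent_set_subset polyfun_mats_square[of i0 1 3]])
    show "(mats v i0 ** mats v i0) $ 1 $ 3 = 0" if "v \<in> bent_set" for v :: "'k ^ ('r \<times> 3 \<times> 3)"
      using that unfolding bent_set_def by (auto simp: bent_tuple_mult)
    let ?v = "standard_tuple (\<lambda>_. 1) (\<lambda>_. 0) :: 'k ^ ('r \<times> 3 \<times> 3)"
    show "?v \<in> commuting_nilpotent" "?v \<in> commuting_nilpotent" by (rule flagged_in_commuting_nilpotent)+
    show "(mats ?v i0 ** mats ?v i0) $ 1 $ 3 \<noteq> 0"
      by (simp add: mats_standard_tuple strict_upper_mult) (simp add: strict_upper_def)
  qed
  then show ?thesis using closure_of_topspace[of "zar (commuting_nilpotent :: ('k ^ ('r \<times> 3 \<times> 3)) set)"] by simp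
qed

lemma irreducible_commuting_nilpotent:
  "irreducible_closed (zar commuting_nilpotent)
    (commuting_nilpotent :: ('k::alg_closed_field ^ ('r::finite \<times> 3 \<times> 3)) set)"
proof -
  have "poly_connected (flagged_set (\<lambda>H s t a b. True) :: ('k ^ ('r \<times> 3 \<times> 3)) set)"
    by (rule poly_connected_flagged) auto
  then have "poly_connected (commuting_nilpotent :: ('k ^ ('r \<times> 3 \<times> 3)) set)"
    unfolding commuting_nilpotent_eq_flagged .
  from irreducible_closure_of_poly_connected[OF this order.refl] show ?thesis
    using closure_of_topspace[of "zar (commuting_nilpotent :: ('k ^ ('r \<times> 3 \<times> 3)) set)"] by simp
qed

lemma bent_closure_not_square_zero:
  "\<not> (bent_closure :: ('k::field ^ ('r::finite \<times> 3 \<times> 3)) set) \<subseteq> square_zero_tuples"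
proof
  assume sub: "(bent_closure :: ('k ^ ('r \<times> 3 \<times> 3)) set) \<subseteq> square_zero_tuples"
  obtain i0 :: 'r where True by simp
  \<comment> \<open>Here \<open>cross u z = e3\<close> and \<open>t = 1\<close>, so each square is
    the outer product of the first basis vector with \<open>cross u e3\<close>, the negative of the
    second.\<close>
  let ?v = "bent_tuple (vector [1, 0, 0]) (\<lambda>_. vector [0, 1, 0]) 1 :: 'k ^ ('r \<times> 3 \<times> 3)"
  have "?v \<in> bent_closure"
    by (rule subsetD[OF closure_of_subset]) (use bent_set_subset in \<open>auto simp: bent_set_def\<close>)
  then have "(mats ?v i0 ** mats ?v i0) $ 1 $ 2 = 0" using sub by (auto simp: square_zero_tuples_def)
  then show False by (simp add: bent_tuple_mult dot_def)
qed

text \<open>Irreducibility places \<open>Z\<close> in the bent closure or in its transpose, both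
  closed, and from there the chain goes up to the whole variety. The first inclusion is strict
  because the bent closure contains tuples with nonzero squares.\<close>

lemma codim_irreducible_ge_2:
  fixes Z :: "('k::alg_closed_field ^ ('r::finite \<times> 3 \<times> 3)) set"
  assumes "irreducible_closed (zar commuting_nilpotent) Z" "Z \<subseteq> square_zero_tuples"
  shows "\<exists>C. C 0 = Z \<and> closed_chain (zar commuting_nilpotent) 2 C"
proof -
  have chain: "\<exists>C. C 0 = Y \<and> closed_chain (zar commuting_nilpotent) 2 C"
    if Y: "irreducible_closed (zar commuting_nilpotent) Y" "Y \<subseteq> square_zero_tuples" "Y \<subseteq> bent_closure"
    for Y :: "('k ^ ('r \<times> 3 \<times> 3)) set"
  proof -
    have "Y \<subset> bent_closure" using Y(2,3) bent_closure_not_square_zero by blast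
    moreover have irr: "irreducible_closed (zar commuting_nilpotent) (bent_closure :: ('k ^ ('r \<times> 3 \<times> 3)) set)"
      by (rule irreducible_closure_of_poly_connected[OF poly_connected_bent_set bent_set_subset])
    ultimately have "closed_chain (zar commuting_nilpotent) 1 ((\<lambda>_. Y)(1 := bent_closure))"
      using closed_chain_Suc[OF closed_chain_0[OF Y(1)] irr] by simp
    from closed_chain_Suc[OF this irreducible_commuting_nilpotent] bent_closure_psubset
    show ?thesis
      by (intro exI[of _ "((\<lambda>_. Y)(1 := bent_closure))(2 := commuting_nilpotent)"]) (simp add: numeral_2_eq_2)
  qed
  let ?T = "\<lambda>v :: 'k ^ ('r \<times> 3 \<times> 3). tup (\<lambda>i. transpose (mats v i))"
  note sym = transpose_linear_symmetry[where 'k = 'k and 'r = 'r]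
  have TT: "?T ` ?T ` A = A" for A by (simp add: image_image)
  have bent: "common_image \<subseteq> (bent_closure :: ('k ^ ('r \<times> 3 \<times> 3)) set)"
    using common_image_subset_bent_set closure_of_subset[of bent_set "zar commuting_nilpotent"] bent_set_subset
    by auto
  have kernel: "common_kernel \<subseteq> ?T ` bent_closure"
  proof
    fix v :: "'k ^ ('r \<times> 3 \<times> 3)"
    assume "v \<in> common_kernel"
    then obtain u w where "\<And>i. mats v i = outer (w i) u \<and> dot u (w i) = 0"
      unfolding common_kernel_def by blast
    then have "mats (?T v) i = outer u (w i) \<and> dot u (w i) = 0" for i
      by (simp add: transpose_def vec_eq_iff mult.commute)
    then have "?T v \<in> common_image" unfolding common_image_def by blast
    then have "?T (?T v) \<in> ?T ` bent_closure" using bent by blast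
    then show "v \<in> ?T ` bent_closure" by simp
  qed
  have "Z \<subseteq> common_image \<union> common_kernel"
    using assms(2) square_zero_tuple_cases unfolding square_zero_tuples_def by blast
  then have "Z \<subseteq> bent_closure \<union> ?T ` bent_closure" using bent kernel by blast
  then consider "Z \<subseteq> bent_closure" | "Z \<subseteq> ?T ` bent_closure"
    using irreducible_closed_subset_Un[OF assms(1) closedin_closure_of
        linear_symmetry_image_closedin[OF sym closedin_closure_of]] by blast
  then show ?thesis
  proof cases
    case 1
    then show ?thesis using chain assms by blast
  next
    \<comment> \<open>For a kernel plane the chain is built above the transpose of \<open>Z\<close>
      and transposed back.\<close>
    case 2
    have "?T ` Z \<subseteq> square_zero_tuples"
    proof
      fix v assume "v \<in> ?T ` Z"
      then obtain z where z: "z \<in> square_zero_tuples" "v = ?T z" using assms(2) by blast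
      then have "v \<in> commuting_nilpotent"
        using sym unfolding linear_symmetry_def square_zero_tuples_def by blast
      moreover have "mats v i ** mats v i = 0" for i
      proof -
        have "mats z i ** mats z i = 0" using z(1) by (simp add: square_zero_tuples_def)
        then have "transpose (mats z i ** mats z i) = 0" by (simp add: transpose_def vec_eq_iff)
        then show ?thesis by (simp add: z(2) matrix_transpose_mul)
      qed
      ultimately show "v \<in> square_zero_tuples" by (simp add: square_zero_tuples_def)
    qed
    moreover have "?T ` Z \<subseteq> bent_closure" using image_mono[OF 2, of ?T] unfolding TT .
    ultimately have "\<exists>C. C 0 = ?T ` Z \<and> closed_chain (zar commuting_nilpotent) 2 C"
      by (rule chain[OF linear_symmetry_image_irreducible[OF sym assms(1)]])
    then obtain C where C: "C 0 = ?T ` Z" "closed_chain (zar commuting_nilpotent) 2 C"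
      by (elim exE conjE)
    have "?T ` C 0 = Z" unfolding C(1) TT ..
    then show ?thesis
      using linear_symmetry_image_chain[OF sym C(2)] by (intro exI[of _ "\<lambda>i. ?T ` C i"] conjI)
  qed
qed

theorem theorem7p2p3:
  fixes N :: "('k::alg_closed_field ^ (3 \<times> 3)) set"
    and C :: "('k ^ ('r::finite \<times> 3 \<times> 3)) set"
  assumes "N = nilpotent_cone"
    and "C = commuting_variety N"
  shows "singular_locus C \<subseteq> commuting_variety subregular_closure \<and>
         2 \<le> codim (subtopology zariski C) (singular_locus C)"
proof
  have sub: "singular_locus C \<subseteq> square_zero_tuples"
    unfolding assms by (rule singular_locus_subset_square_zero)
  then show "singular_locus C \<subseteq> commuting_variety subregular_closure"
    using square_zero_tuples_subset by blast
  show "2 \<le> codim (subtopology zariski C) (singular_locus C)"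
    unfolding codim_def
  \<comment> \<open>It suffices to bound the codimension of each irreducible closed \<open>Z\<close>
    inside the locus; if there is none, the infimum is \<infinity>.\<close>
  proof (intro Inf_greatest)
    fix d assume "d \<in> {codim_irreducible (zar C) Z |Z. irreducible_closed (zar C) Z \<and> Z \<subseteq> singular_locus C}"
    then obtain Z where Z: "d = codim_irreducible (zar C) Z" "irreducible_closed (zar C) Z" "Z \<subseteq> square_zero_tuples"
      using sub by blast
    obtain Y where "Y 0 = Z" "closed_chain (zar C) 2 Y"
      using codim_irreducible_ge_2[OF Z(2)[unfolded assms] Z(3)] unfolding assms by (elim exE conjE)
    then have "enat 2 \<le> codim_irreducible (zar C) Z"
      unfolding codim_irreducible_altdef by (intro Sup_upper) blast
    then show "2 \<le> d" unfolding Z(1) by (simp add: numeral_eq_enat)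
  qed
qed

end
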